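(* Let $\Omega\subset\mathbb{R}^3$ be a bounded domain and let $u$ be smooth in $\Omega$ and continuous on $\overline\Omega$, with $\lambda(D^2u)=(\lambda_1,\lambda_2,\lambda_3)\in P_2^{1/2}$ at every point of $\Omega$, solving the Dirichlet problem $$(\lambda_1+\lambda_2)(\lambda_1+\lambda_3)(\lambda_2+\lambda_3)=1\ \text{ in }\Omega,\qquad u=0\ \text{ on }\partial\Omega .$$ Then $$(-u)^\beta\,\Delta u\le C\quad\text{in }\Omega,$$ where the constants $C>0$ and $\beta>0$ depend only on $\|u\|_{C^0}$ and the diameter of $\Omega$.
   Context: For a smooth function $u$, $\lambda(D^2u)=(\lambda_1,\lambda_2,\lambda_3)$ denotes the eigenvalues of the Hessian matrix $D^2u$, and $\|u\|_{C^0}=\sup_\Omega|u|$. The cone $P_2^{1/2}$ is $$P_2^{1/2}:=\Big\{\lambda\in\mathbb{R}^3:\ \lambda_{i_1}+\lambda_{i_2}>0\ \ \forall\, i_1\ne i_2,\ \text{ and }\ \lambda_{\min}\ge -\tfrac12\lambda_{\max}\Big\},$$ where $\lambda_{\max}$ and $\lambda_{\min}$ are the maximum and minimum of $\lambda_1,\lambda_2,\lambda_3$. (The conditions imply $\Delta u>0$, hence $u<0$ in $\Omega$, so that $(-u)^\beta$ is well defined.) *)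

theory Defs
  imports "HOL-Analysis.Analysis"
begin

text \<open>The notions below are meant for open sets \<open>S\<close>: the value of \<^const>\<open>frechet_derivative\<close> at a
  point of \<open>S\<close> then only depends on the function near that point, so the values of a total
  function outside \<open>S\<close> play no role.\<close>

primrec Ck_on :: "nat \<Rightarrow> (real ^ 'n \<Rightarrow> real) \<Rightarrow> (real ^ 'n) set \<Rightarrow> bool" where
  "Ck_on 0 f S \<longleftrightarrow> continuous_on S f"
| "Ck_on (Suc k) f S \<longleftrightarrow>
     (\<forall>x\<in>S. f differentiable (at x)) \<and> (\<forall>v. Ck_on k (\<lambda>x. frechet_derivative f (at x) v) S)"

definition smooth_on :: "(real ^ 'n \<Rightarrow> real) \<Rightarrow> (real ^ 'n) set \<Rightarrow> bool" where
  "smooth_on f S \<longleftrightarrow> (\<forall>k. Ck_on k f S)"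

definition partial_deriv :: "'n \<Rightarrow> (real ^ 'n \<Rightarrow> real) \<Rightarrow> real ^ 'n \<Rightarrow> real" where
  "partial_deriv i f x = frechet_derivative f (at x) (axis i 1)"

definition hessian :: "(real ^ 'n \<Rightarrow> real) \<Rightarrow> real ^ 'n \<Rightarrow> real ^ 'n ^ 'n" where
  "hessian f x = (\<chi> i j. partial_deriv i (partial_deriv j f) x)"

definition laplacian :: "(real ^ 'n \<Rightarrow> real) \<Rightarrow> real ^ 'n \<Rightarrow> real" where
  "laplacian f x = (\<Sum>i\<in>UNIV. partial_deriv i (partial_deriv i f) x)"

text \<open>The entries of \<open>l\<close>, in any order, are the eigenvalues of \<open>A\<close> listed with multiplicity:
  they are the roots of the characteristic polynomial of \<open>A\<close>.\<close>

definition is_eigenvalues :: "real ^ 'n ^ 'n \<Rightarrow> real ^ 'n \<Rightarrow> bool" where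
  "is_eigenvalues A l \<longleftrightarrow> (\<forall>t. det (mat t - A) = (\<Prod>i\<in>UNIV. t - l $ i))"

definition P2_half :: "(real ^ 3) set" where
  "P2_half = {l. (\<forall>i j. i \<noteq> j \<longrightarrow> l $ i + l $ j > 0) \<and>
                 Min (range (\<lambda>i. l $ i)) \<ge> - (1/2) * Max (range (\<lambda>i. l $ i))}"

definition sup_norm_on :: "'a set \<Rightarrow> ('a \<Rightarrow> real) \<Rightarrow> real" where
  "sup_norm_on S f = (SUP x\<in>S. \<bar>f x\<bar>)"

definition bounded_domain :: "(real ^ 'n) set \<Rightarrow> bool" where
  "bounded_domain S \<longleftrightarrow> open S \<and> connected S \<and> S \<noteq> {} \<and> bounded S"

end

theory Submission
  imports Defs
begin

text \<open>
  Write \<open>S = \<Delta>u\<close> and \<open>b\<^sub>i = S - \<lambda>\<^sub>i\<close>, so that the equation is \<open>det (S I - D\<^sup>2u) = 1\<close> and the linearised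
  operator in an eigenframe has the coefficients \<open>F\<^sub>k = (\<Sum>i\<noteq>k. 1/b\<^sub>i)\<close>. Differentiating the equation
  twice and summing over the frame expresses \<open>\<Sum>F\<^sub>k S\<^sub>k\<^sub>k\<close> as a positive quadratic form in the third
  derivatives. The condition \<open>\<lambda>\<^sub>m\<^sub>i\<^sub>n \<ge> - \<lambda>\<^sub>m\<^sub>a\<^sub>x / 2\<close> makes the two larger \<open>b\<^sub>i\<close> comparable to \<open>S\<close> and the
  smallest one of size \<open>S\<^sup>-\<^sup>2\<close>, and for \<open>S \<ge> 11\<close> this yields the Jacobi inequality
  \<open>\<Sum>F\<^sub>k S\<^sub>k\<^sub>k \<ge> 11/10 * \<Sum>F\<^sub>k S\<^sub>k\<^sup>2 / S\<close>. The factor exceeds 1, so at a maximum point of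
  \<open>20 ln (-u) + ln S + 5 |x - c|\<^sup>2 / (2 d\<^sup>2)\<close> the gradient terms are absorbed without a gradient bound, and
  what remains, \<open>\<Sum>F\<^sub>k \<ge> 2 S\<^sup>2 / 9\<close> against \<open>60 / (-u)\<close>, bounds \<open>S\<^sup>2 (-u)\<close> by a multiple of \<open>d\<^sup>2\<close>.
\<close>

section \<open>Directional derivatives\<close>

abbreviation dderiv :: "'a \<Rightarrow> ('a::real_normed_vector \<Rightarrow> real) \<Rightarrow> 'a \<Rightarrow> real" where
  "dderiv v f x \<equiv> frechet_derivative f (at x) v"

lemma dderiv_cong:
  assumes "open S" "x \<in> S" "\<And>y. y \<in> S \<Longrightarrow> f y = g y"
  shows "dderiv v f x = dderiv v g x"
proof -
  have "(f has_derivative f') (at x) \<longleftrightarrow> (g has_derivative f') (at x)" for f'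
    using assms has_derivative_transform_within_open by (metis (no_types, lifting))
  then show ?thesis
    by (simp add: frechet_derivative_def)
qed

text \<open>The mean value arguments and the maximum conditions below are all run on lines, in one
  variable; this is the bridge from the Frechet derivative.\<close>

lemma has_real_derivative_line:
  assumes "f differentiable (at (x + t *\<^sub>R v))"
  shows "((\<lambda>t. f (x + t *\<^sub>R v)) has_real_derivative dderiv v f (x + t *\<^sub>R v)) (at t within T)"
proof -
  let ?D = "frechet_derivative f (at (x + t *\<^sub>R v))"
  have D: "(f has_derivative ?D) (at (x + t *\<^sub>R v))"
    using assms frechet_derivative_works by blast
  have "((\<lambda>t. x + t *\<^sub>R v) has_derivative (\<lambda>h. h *\<^sub>R v)) (at t within T)"
    by (auto intro!: derivative_eq_intros)
  then have "((\<lambda>t. f (x + t *\<^sub>R v)) has_derivative (\<lambda>h. ?D (h *\<^sub>R v))) (at t within T)"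
    using D by (rule has_derivative_compose)
  moreover have "(\<lambda>h. ?D (h *\<^sub>R v)) = (*) (?D v)"
    using linear_frechet_derivative[OF assms] by (auto simp: linear_cmul)
  ultimately show ?thesis
    by (simp add: has_field_derivative_def)
qed

lemma dderiv_linear:
  assumes "f differentiable (at x)"
  shows "linear (\<lambda>v. dderiv v f x)"
  using linear_frechet_derivative[OF assms] by simp

lemma dderiv_expand:
  fixes f :: "real ^ 'n \<Rightarrow> real"
  assumes "f differentiable (at x)"
  shows "dderiv v f x = (\<Sum>k\<in>UNIV. v $ k * dderiv (axis k 1) f x)"
proof -
  have "dderiv v f x = dderiv (\<Sum>k\<in>UNIV. v $ k *\<^sub>R axis k 1) f x"
    by (simp add: basis_expansion scalar_mult_eq_scaleR[symmetric])
  also have "\<dots> = (\<Sum>k\<in>UNIV. v $ k * dderiv (axis k 1) f x)"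
    using dderiv_linear[OF assms] by (simp add: linear_sum linear_cmul)
  finally show ?thesis .
qed

lemma dderiv_lincomb:
  assumes "finite K" "\<And>k. k \<in> K \<Longrightarrow> g k differentiable (at x)"
  shows "dderiv v (\<lambda>y. \<Sum>k\<in>K. c k * g k y) x = (\<Sum>k\<in>K. c k * dderiv v (g k) x)"
proof -
  have "((\<lambda>y. \<Sum>k\<in>K. c k * g k y) has_derivative
      (\<lambda>v. \<Sum>k\<in>K. c k * frechet_derivative (g k) (at x) v)) (at x)"
    by (intro has_derivative_sum has_derivative_mult_right)
      (use assms frechet_derivative_works in blast)
  from fun_cong[OF frechet_derivative_at[OF this], of v] show ?thesis
    by (rule sym)
qed

lemma Ck_on_Suc_differentiable: "Ck_on (Suc k) f S \<Longrightarrow> x \<in> S \<Longrightarrow> f differentiable (at x)"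
  by simp

lemma Ck_on_dderiv: "Ck_on (Suc k) f S \<Longrightarrow> Ck_on k (dderiv v f) S"
  by simp

lemma Ck_on_continuous:
  assumes "Ck_on k f S"
  shows "continuous_on S f"
proof (cases k)
  case 0
  then show ?thesis using assms by simp
next
  case (Suc j)
  then show ?thesis
    using assms by (meson Ck_on_Suc_differentiable continuous_at_imp_continuous_on
        differentiable_imp_continuous_within)
qed

section \<open>Symmetry of second derivatives\<close>

text \<open>The mean value theorem, used in direction \<open>a\<close> and then in direction
  \<open>b\<close>, turns the quotient into a value of \<open>dderiv b (dderiv a f)\<close> inside
  the small parallelogram at \<open>x\<close>; continuity then gives the limit.\<close>

lemma second_difference_tendsto:
  fixes f :: "real ^ 'n \<Rightarrow> real"
  assumes S: "open S" "x \<in> S" and f: "Ck_on (Suc (Suc 0)) f S"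
  shows "((\<lambda>s. (f (x + s *\<^sub>R a + s *\<^sub>R b) - f (x + s *\<^sub>R a) - f (x + s *\<^sub>R b) + f x) / s^2)
    \<longlongrightarrow> dderiv b (dderiv a f) x) (at_right 0)"
proof (rule tendstoI)
  fix e :: real assume "e > 0"
  have "continuous (at x) (dderiv b (dderiv a f))"
    using f S by (simp add: continuous_on_eq_continuous_at)
  then obtain d0 where d0: "d0 > 0" "\<And>y. dist y x < d0 \<Longrightarrow> dist (dderiv b (dderiv a f) y) (dderiv b (dderiv a f) x) < e"
    using \<open>e > 0\<close> unfolding continuous_at_eps_delta by blast
  obtain d1 where d1: "d1 > 0" "ball x d1 \<subseteq> S"
    using S openE by blast
  \<comment> \<open>This scaling keeps every \<open>x + r a + t b\<close> with \<open>r\<close>,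
    \<open>t\<close> in \<open>[0, d)\<close> within \<open>min d0 d1\<close> of \<open>x\<close>.
    The summand 1 covers the case \<open>a = b = 0\<close>.\<close>
  define d where "d = min d0 d1 / (norm a + norm b + 1)"
  have dpos: "d > 0"
    using d0 d1 by (auto simp: d_def intro!: divide_pos_pos add_nonneg_pos)
  have near: "dist (x + r *\<^sub>R a + t *\<^sub>R b) x < min d0 d1"
    if "0 \<le> r" "r \<le> s" "0 \<le> t" "t \<le> s" "s < d" for r t s
  proof -
    have "dist (x + r *\<^sub>R a + t *\<^sub>R b) x = norm (r *\<^sub>R a + t *\<^sub>R b)"
      by (simp add: dist_norm)
    also have "\<dots> \<le> r * norm a + t * norm b"
      using that by (intro norm_triangle_le) simp
    also have "\<dots> \<le> s * norm a + s * norm b"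
      using that by (intro add_mono mult_right_mono) auto
    also have "\<dots> \<le> s * (norm a + norm b + 1)"
      using that by (simp add: algebra_simps)
    also have "\<dots> < d * (norm a + norm b + 1)"
      using that by (intro mult_strict_right_mono) (auto intro: add_nonneg_pos)
    also have "\<dots> = min d0 d1"
      by (simp add: d_def add_nonneg_eq_0_iff add_eq_0_iff_both_eq_0 less_imp_neq[symmetric] add_nonneg_pos)
    finally show ?thesis .
  qed
  then have inS: "x + r *\<^sub>R a + t *\<^sub>R b \<in> S"
    if "0 \<le> r" "r \<le> s" "0 \<le> t" "t \<le> s" "s < d" for r t s
    using d1(2) that by (force simp: dist_commute)
  have "dist ((f (x + s *\<^sub>R a + s *\<^sub>R b) - f (x + s *\<^sub>R a) - f (x + s *\<^sub>R b) + f x) / s^2)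
      (dderiv b (dderiv a f) x) < e" if s: "0 < s" "s < d" for s
  proof -
    define g where "g r = f ((x + s *\<^sub>R b) + r *\<^sub>R a) - f (x + r *\<^sub>R a)" for r
    have "(g has_real_derivative dderiv a f ((x + s *\<^sub>R b) + r *\<^sub>R a) - dderiv a f (x + r *\<^sub>R a)) (at r)"
      if r: "0 \<le> r" "r \<le> s" for r
      unfolding g_def
      using inS[of r s 0] inS[of r s s] r s f
      by (intro DERIV_diff has_real_derivative_line) (auto simp: algebra_simps)
    from MVT2[OF s(1) this] obtain \<xi> where \<xi>: "0 < \<xi>" "\<xi> < s"
      "g s - g 0 = s * (dderiv a f ((x + s *\<^sub>R b) + \<xi> *\<^sub>R a) - dderiv a f (x + \<xi> *\<^sub>R a))"
      by auto
    have "((\<lambda>t. dderiv a f ((x + \<xi> *\<^sub>R a) + t *\<^sub>R b)) has_real_derivative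
        dderiv b (dderiv a f) ((x + \<xi> *\<^sub>R a) + t *\<^sub>R b)) (at t)" if "0 \<le> t" "t \<le> s" for t
      using inS[of \<xi> s t] that s \<xi> f by (intro has_real_derivative_line) auto
    from MVT2[OF s(1) this] obtain \<eta> where \<eta>: "0 < \<eta>" "\<eta> < s"
      "dderiv a f ((x + \<xi> *\<^sub>R a) + s *\<^sub>R b) - dderiv a f (x + \<xi> *\<^sub>R a)
        = s * dderiv b (dderiv a f) ((x + \<xi> *\<^sub>R a) + \<eta> *\<^sub>R b)"
      by auto
    have "g s - g 0 = s^2 * dderiv b (dderiv a f) (x + \<xi> *\<^sub>R a + \<eta> *\<^sub>R b)"
      using \<xi>(3) \<eta>(3) by (simp add: algebra_simps power2_eq_square)
    then have "(f (x + s *\<^sub>R a + s *\<^sub>R b) - f (x + s *\<^sub>R a) - f (x + s *\<^sub>R b) + f x) / s^2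
        = dderiv b (dderiv a f) (x + \<xi> *\<^sub>R a + \<eta> *\<^sub>R b)"
      using s by (simp add: g_def field_simps)
    then show ?thesis
      using d0(2)[of "x + \<xi> *\<^sub>R a + \<eta> *\<^sub>R b"] near[of \<xi> s \<eta>] \<xi> \<eta> s by auto
  qed
  then show "\<forall>\<^sub>F s in at_right 0. dist ((f (x + s *\<^sub>R a + s *\<^sub>R b) - f (x + s *\<^sub>R a) - f (x + s *\<^sub>R b) + f x) / s^2)
      (dderiv b (dderiv a f) x) < e"
    using dpos by (auto simp: eventually_at_right_field)
qed

text \<open>The second difference quotient is symmetric in \<open>a\<close> and \<open>b\<close>, so
  both mixed derivatives are its limit.\<close>

lemma dderiv_commute:
  fixes f :: "real ^ 'n \<Rightarrow> real"
  assumes "open S" "x \<in> S" "Ck_on (Suc (Suc k)) f S"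
  shows "dderiv a (dderiv b f) x = dderiv b (dderiv a f) x"
proof -
  have f: "Ck_on (Suc (Suc 0)) f S"
    using assms(3) by (simp only: Ck_on.simps) (blast intro: Ck_on_continuous)
  have "((\<lambda>s. (f (x + s *\<^sub>R b + s *\<^sub>R a) - f (x + s *\<^sub>R b) - f (x + s *\<^sub>R a) + f x) / s^2)
    \<longlongrightarrow> dderiv a (dderiv b f) x) (at_right 0)"
    by (rule second_difference_tendsto[OF assms(1,2) f])
  moreover have "(\<lambda>s. (f (x + s *\<^sub>R b + s *\<^sub>R a) - f (x + s *\<^sub>R b) - f (x + s *\<^sub>R a) + f x) / s^2)
    = (\<lambda>s. (f (x + s *\<^sub>R a + s *\<^sub>R b) - f (x + s *\<^sub>R a) - f (x + s *\<^sub>R b) + f x) / s^2)"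
    by (auto simp: algebra_simps)
  ultimately show ?thesis
    using second_difference_tendsto[OF assms(1,2) f, of a b] tendsto_unique trivial_limit_at_right_real
    by fastforce
qed

text \<open>If \<open>f' 0 = 0\<close> and \<open>f'' > 0\<close>, then \<open>f'\<close> is
  positive just to the right of 0, and the mean value theorem lifts \<open>f\<close> above
  \<open>f 0\<close>.\<close>

lemma second_derivative_test:
  fixes f :: "real \<Rightarrow> real"
  assumes e: "e > 0"
    and f: "\<And>t. \<bar>t\<bar> < e \<Longrightarrow> (f has_real_derivative f' t) (at t)"
    and f': "(f' has_real_derivative f'') (at 0)"
    and max: "\<And>t. \<bar>t\<bar> < e \<Longrightarrow> f t \<le> f 0"
  shows "f' 0 = 0" "f'' \<le> 0"
proof -
  show z: "f' 0 = 0"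
    using DERIV_local_max[OF f[of 0] e] e max by (simp add: abs_minus_commute)
  show "f'' \<le> 0"
  proof (rule ccontr)
    assume "\<not> f'' \<le> 0"
    then obtain d where d: "d > 0" "\<And>h. 0 < h \<Longrightarrow> h < d \<Longrightarrow> 0 < f' h"
      using DERIV_pos_inc_right[OF f'] z by force
    define s where "s = min d e / 2"
    have s: "0 < s" "s < d" "s < e"
      using d e by (auto simp: s_def)
    obtain z where "0 < z" "z < s" "f s - f 0 = s * f' z"
      using MVT2[of 0 s f f'] f s by auto
    moreover have "0 < f' z"
      using d calculation s by auto
    ultimately show False
      using max[of s] s(3) mult_pos_pos[OF s(1), of "f' z"] s(1) by linarith
  qed
qed

section \<open>The Jacobi inequality\<close>

text \<open>Since \<open>c / b \<ge> 20\<close>, the right-hand side times \<open>b * c\<close> is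
  at least \<open>2 (T - x)^2 + 20 x^2\<close>. Its minimum over \<open>x\<close> is
  \<open>20/11 T^2\<close>, slightly more than \<open>9/5 T^2\<close>.\<close>

lemma weighted_square_bound:
  fixes b c T x :: real
  assumes "0 < b" "20 * b \<le> c"
  shows "9/5 * T^2 / (b * c) \<le> 2 * (T - x)^2 / (b * c) + x^2 / b^2"
proof -
  have "0 < c" using assms by linarith
  have "0 \<le> (T/5 - 2*x)^2 * 5 + 2 * x^2"
    by simp
  then have "9/5 * T^2 \<le> 2 * (T - x)^2 + 20 * x^2"
    by (simp add: power2_eq_square algebra_simps)
  also have "\<dots> \<le> 2 * (T - x)^2 + c / b * x^2"
    using assms by (intro add_mono mult_right_mono) (auto simp: field_simps)
  finally have "9/5 * T^2 / (b * c) \<le> (2 * (T - x)^2 + c / b * x^2) / (b * c)"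
    using assms \<open>0 < c\<close> by (intro divide_right_mono) auto
  also have "\<dots> = 2 * (T - x)^2 / (b * c) + x^2 / b^2"
    using assms \<open>0 < c\<close> by (simp add: field_simps power2_eq_square)
  finally show ?thesis .
qed

text \<open>This serves a direction whose coefficient contains the dominant \<open>1/b\<close>. The
  term \<open>1/d\<close> is absorbed by \<open>11/10 * 21/20 < 6/5\<close>, and
  \<open>1/S \<le> 3/2 * (1/c)\<close> then produces the \<open>9/5\<close> of
  \<open>weighted_square_bound\<close>.\<close>

lemma jacobi_large_coefficient:
  fixes b c d S T x :: real
  assumes "0 < b" "20 * b \<le> c" "20 * b \<le> d" "c \<le> 3/2 * S"
  shows "11/10 * (1/b + 1/d) * T^2 / S \<le> 2 * (T - x)^2 / (b * c) + x^2 / b^2"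
proof -
  have pos: "0 < c" "0 < d" "0 < S" using assms by linarith+
  have "1/d \<le> 1/20 * (1/b)"
    using assms pos by (simp add: field_simps)
  then have "11/10 * (1/b + 1/d) \<le> 6/5 * (1/b)"
    using assms(1) pos by (simp add: field_simps)
  then have "11/10 * (1/b + 1/d) * T^2 / S \<le> 6/5 * (1/b) * T^2 / S"
    using pos by (intro divide_right_mono mult_right_mono) auto
  also have "\<dots> = 6/5 * T^2 / b * (1/S)"
    by simp
  also have "\<dots> \<le> 6/5 * T^2 / b * (3/2 * (1/c))"
    using assms pos by (intro mult_left_mono) (auto simp: field_simps)
  also have "\<dots> = 9/5 * T^2 / (b * c)"
    by simp
  finally show ?thesis
    using weighted_square_bound[OF assms(1,2), of T x] by linarith
qed

text \<open>This serves the direction whose coefficient lacks \<open>1/b\<close>. By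
  \<open>eq\<close>, the square \<open>x^2 / b^2\<close> equals \<open>Y^2\<close> with
  \<open>Y = y/c + z/d\<close>, and \<open>(1/c + 1/d) T = Y + (T - y)/c + (T - z)/d\<close> splits
  the left-hand side into quantities that the right-hand side controls.\<close>

lemma jacobi_small_coefficient:
  fixes b c d S T x y z :: real
  assumes "0 < b" "20 * b \<le> c" "20 * b \<le> d" "c + d \<le> 2 * S"
    and eq: "x / b + y / c + z / d = 0"
  shows "11/10 * (1/c + 1/d) * T^2 / S
    \<le> x^2 / b^2 + y^2 / c^2 + z^2 / d^2 + 2 * (T - y)^2 / (b * c) + 2 * (T - z)^2 / (b * d)"
proof -
  have pos: "0 < c" "0 < d" "0 < S" using assms by linarith+
  define p q where "p = 1/c" and "q = 1/d"
  have pq: "0 < p" "0 < q" using pos by (auto simp: p_def q_def)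
  define Y where "Y = p * y + q * z"
  have xb: "x^2 / b^2 = Y^2"
  proof -
    have "x / b = - Y" using eq by (simp add: Y_def p_def q_def)
    then show ?thesis by (metis power2_minus power_divide)
  qed
  have big: "40 * (r * T - r * w)^2 \<le> 2 * (T - w)^2 / (b * e)"
    if "r = 1/e" "20 * b \<le> e" "0 < e" for r e w
  proof -
    have "20 * r \<le> 1/b" "0 \<le> r"
      unfolding that(1) using that assms(1) by (simp_all add: field_simps)
    have "40 * (r * T - r * w)^2 = 2 * (20 * r) * r * (T - w)^2"
      by (simp add: power2_eq_square algebra_simps)
    also have "\<dots> \<le> 2 * (1/b) * r * (T - w)^2"
      using \<open>20 * r \<le> 1/b\<close> \<open>0 \<le> r\<close> by (intro mult_right_mono mult_left_mono) auto
    also have "\<dots> = 2 * (T - w)^2 / (b * e)"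
      using that by simp
    finally show ?thesis .
  qed
  have cd: "y^2 / c^2 = (p * y)^2" "z^2 / d^2 = (q * z)^2"
    by (simp_all add: p_def q_def power_divide)
  have "11/10 * (1/c + 1/d) * T^2 / S = 11/10 * T^2 * ((p + q) / S)"
    by (simp add: p_def q_def)
  also have "\<dots> \<le> 11/10 * T^2 * (2 * p * q)"
  proof (intro mult_left_mono)
    have "(p + q) = p * q * (c + d)"
      using pos by (simp add: p_def q_def field_simps)
    also have "\<dots> \<le> p * q * (2 * S)"
      using assms pq by (intro mult_left_mono) auto
    finally show "(p + q) / S \<le> 2 * p * q"
      using pos by (simp add: field_simps)
  qed auto
  also have "\<dots> \<le> 11/20 * ((p + q) * T)^2"
  proof -
    have "0 \<le> 11/20 * ((p - q)^2 * T^2)" by simp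
    then have "11/10 * T^2 * (2 * p * q) \<le> 11/20 * ((p - q)^2 * T^2 + 4 * p * q * T^2)"
      by (simp add: algebra_simps)
    also have "\<dots> = 11/20 * ((p + q) * T)^2"
      by (simp add: power2_eq_square algebra_simps)
    finally show ?thesis .
  qed
  also have "\<dots> \<le> Y^2 + (p * y)^2 + (q * z)^2 + 40 * (p * T - p * y)^2 + 40 * (q * T - q * z)^2"
  proof -
    \<comment> \<open>Splitting the square leaves \<open>11/10 Y^2\<close>. Its excess
      \<open>1/10 Y^2\<close> is paid by \<open>(p * y)^2\<close> and \<open>(q * z)^2\<close>,
      while \<open>P^2\<close> and \<open>Q^2\<close> use only 11/5 of the available 40.\<close>
    define P Q where "P = p * T - p * y" and "Q = q * T - q * z"
    have 1: "(p + q) * T = Y + (P + Q)"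
      by (simp add: Y_def P_def Q_def algebra_simps)
    have "(Y + (P + Q))^2 \<le> 2 * Y^2 + 2 * (P + Q)^2"
      using sum_squares_bound[of Y "P + Q"] by (simp add: power2_eq_square algebra_simps)
    moreover have "(P + Q)^2 \<le> 2 * P^2 + 2 * Q^2"
      using sum_squares_bound[of P Q] by (simp add: power2_eq_square algebra_simps)
    moreover have "Y^2 \<le> 2 * (p * y)^2 + 2 * (q * z)^2"
      using sum_squares_bound[of "p * y" "q * z"] by (simp add: Y_def power2_eq_square algebra_simps)
    moreover have "0 \<le> P^2" "0 \<le> Q^2" "0 \<le> Y^2"
      by auto
    ultimately show ?thesis
      unfolding 1 P_def[symmetric] Q_def[symmetric] by argo
  qed
  also have "\<dots> \<le> Y^2 + (p * y)^2 + (q * z)^2 + 2 * (T - y)^2 / (b * c) + 2 * (T - z)^2 / (b * d)"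
    using big[OF p_def assms(2) pos(1), of y] big[OF q_def assms(3) pos(2), of z] by linarith
  finally show ?thesis
    unfolding xb cd .
qed

text \<open>Here \<open>t_ijk\<close> stands for third derivatives of \<open>u\<close> and
  \<open>T_m\<close> for the gradient of the Laplacian; the right-hand side adds up the quadratic
  forms obtained by differentiating the equation twice in each frame direction. Direction 1 takes
  the three squares of its own group and borrows the \<open>t122\<close> and \<open>t133\<close>
  cross terms of the other two. Directions 2 and 3 each need one square with weight
  \<open>1 / b1^2\<close> and the cross term \<open>t112\<close> or \<open>t113\<close> of the first
  group. Everything left over is nonnegative.\<close>

lemma jacobi_inequality:
  fixes b1 b2 b3 S :: real
  assumes b: "0 < b1" "20 * b1 \<le> b2" "b2 \<le> b3" "S = (b1 + b2 + b3) / 2" "b3 \<le> 3/2 * S"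
    and T: "T1 = t111 + t122 + t133" "T2 = t112 + t222 + t233" "T3 = t113 + t223 + t333"
    and c1: "(T1 - t111) / b1 + (T1 - t122) / b2 + (T1 - t133) / b3 = 0"
  shows "11/10 * ((1/b2 + 1/b3) * T1^2 + (1/b1 + 1/b3) * T2^2 + (1/b1 + 1/b2) * T3^2) / S
    \<le> ((T1 - t111)^2 / b1^2 + (T1 - t122)^2 / b2^2 + (T1 - t133)^2 / b3^2
        + 2 * (t112^2 / (b1 * b2) + t113^2 / (b1 * b3) + t123^2 / (b2 * b3)))
    + ((T2 - t112)^2 / b1^2 + (T2 - t222)^2 / b2^2 + (T2 - t233)^2 / b3^2
        + 2 * (t122^2 / (b1 * b2) + t123^2 / (b1 * b3) + t223^2 / (b2 * b3)))
    + ((T3 - t113)^2 / b1^2 + (T3 - t223)^2 / b2^2 + (T3 - t333)^2 / b3^2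
        + 2 * (t123^2 / (b1 * b2) + t133^2 / (b1 * b3) + t233^2 / (b2 * b3)))"
proof -
  have pos: "0 < b2" "0 < b3" "b2 \<le> 3/2 * S" "20 * b1 \<le> b3" "b2 + b3 \<le> 2 * S"
    using b by (simp_all add: field_simps)
  have 1: "11/10 * (1/b2 + 1/b3) * T1^2 / S
    \<le> (T1 - t111)^2 / b1^2 + (T1 - t122)^2 / b2^2 + (T1 - t133)^2 / b3^2
      + 2 * (t122^2 / (b1 * b2)) + 2 * (t133^2 / (b1 * b3))"
    using jacobi_small_coefficient[OF b(1,2) pos(4,5) c1, of T1] by simp
  have 2: "11/10 * (1/b1 + 1/b3) * T2^2 / S \<le> 2 * (t112^2 / (b1 * b2)) + (T2 - t112)^2 / b1^2"
    using jacobi_large_coefficient[OF b(1,2) pos(4,3), of T2 "T2 - t112"] by simp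
  have 3: "11/10 * (1/b1 + 1/b2) * T3^2 / S \<le> 2 * (t113^2 / (b1 * b3)) + (T3 - t113)^2 / b1^2"
    using jacobi_large_coefficient[OF b(1) pos(4) b(2) b(5), of T3 "T3 - t113"] by simp
  have nn: "0 \<le> t123^2 / (b2 * b3)" "0 \<le> t123^2 / (b1 * b3)" "0 \<le> t123^2 / (b1 * b2)"
    "0 \<le> t223^2 / (b2 * b3)" "0 \<le> t233^2 / (b2 * b3)"
    "0 \<le> (T2 - t222)^2 / b2^2" "0 \<le> (T2 - t233)^2 / b3^2"
    "0 \<le> (T3 - t223)^2 / b2^2" "0 \<le> (T3 - t333)^2 / b3^2"
    using b(1) pos by simp_all
  have split: "11/10 * ((1/b2 + 1/b3) * T1^2 + (1/b1 + 1/b3) * T2^2 + (1/b1 + 1/b2) * T3^2) / S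
    = 11/10 * (1/b2 + 1/b3) * T1^2 / S + 11/10 * (1/b1 + 1/b3) * T2^2 / S + 11/10 * (1/b1 + 1/b2) * T3^2 / S"
    by (simp only: ring_distribs add_divide_distrib mult.assoc)
  have arith: "L1 + L2 + L3 \<le> (a1 + a2 + a3 + 2 * (p + q + r)) + (d1 + d2 + d3 + 2 * (p' + q' + r'))
      + (e1 + e2 + e3 + 2 * (p'' + q'' + r''))"
    if "L1 \<le> a1 + a2 + a3 + 2 * p' + 2 * q''" "L2 \<le> 2 * p + d1" "L3 \<le> 2 * q + e1"
      "0 \<le> r" "0 \<le> q'" "0 \<le> p''" "0 \<le> r'" "0 \<le> r''" "0 \<le> d2" "0 \<le> d3" "0 \<le> e2" "0 \<le> e3"
    for L1 L2 L3 a1 a2 a3 p q r d1 d2 d3 p' q' r' e1 e2 e3 p'' q'' r'' :: real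
    using that by argo
  show ?thesis
    unfolding split by (rule arith; fact)
qed

text \<open>With \<open>b1 = \<lambda>2 + \<lambda>3\<close> and so on, \<open>half\<close> is the
  cone condition \<open>\<lambda>3 \<ge> - \<lambda>1 / 2\<close>. It gives
  \<open>b2 \<ge> S/6\<close> next to \<open>b3 \<ge> 2S/3\<close>, and the equation turns these
  into \<open>1/b1 = b2 * b3 \<ge> S^2 / 9\<close>.\<close>

lemma eigenvalue_gap:
  fixes b1 b2 b3 S :: real
  assumes "0 < b1" "b1 \<le> b2" "b2 \<le> b3" "b1 * b2 * b3 = 1"
    and S: "S = (b1 + b2 + b3) / 2" "11 \<le> S" and half: "b3 \<le> b1 + 3 * b2"
  shows "20 * b1 \<le> b2" "b3 \<le> 3/2 * S" "2 * S^2 / 9 \<le> 2 / b1"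
proof -
  have b3: "2/3 * S \<le> b3" and b2: "1/6 * S \<le> b2"
    using assms by (simp_all add: field_simps)
  have "(1/6 * S) * (2/3 * S) \<le> b2 * b3"
    using b2 b3 S(2) by (intro mult_mono) auto
  moreover have "1 / b1 = b2 * b3"
    using assms by (simp add: field_simps)
  ultimately have inv: "S^2 / 9 \<le> 1 / b1"
    by (simp add: power2_eq_square)
  then show "2 * S^2 / 9 \<le> 2 / b1"
    by linarith
  \<comment> \<open>The threshold 11 is the least integer whose cube exceeds \<open>9 * 120\<close>.
    The resulting \<open>120 * b1 \<le> S\<close> is the gap of 20, since
    \<open>S \<le> 6 * b2\<close>.\<close>
  have "S * S * S \<ge> 11 * 11 * 11"
    using S(2) by (intro mult_mono) auto
  then have "120 / S \<le> S^2 / 9"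
    using S(2) by (simp add: field_simps power2_eq_square)
  with inv have "120 / S \<le> 1 / b1" by linarith
  then have "120 * b1 \<le> S"
    using assms(1) S(2) by (simp add: field_simps)
  then show "20 * b1 \<le> b2" using b2 by linarith
  show "b3 \<le> 3/2 * S"
    using assms by (simp add: field_simps)
qed

section \<open>The equation differentiated twice along a line\<close>

text \<open>The functions are the entries of a symmetric matrix of determinant 1, with diagonal
  \<open>a\<close>, \<open>b\<close>, \<open>c\<close> and off-diagonal \<open>p\<close>,
  \<open>q\<close>, \<open>r\<close>, which is diagonal at 0. The first derivative of the
  determinant gives the linear relation; the second, after this relation has removed the mixed
  products, gives the quadratic form.\<close>

lemma det3_second_derivative:
  fixes a b c p q r :: "real \<Rightarrow> real"
  assumes e: "e > 0"
    and det: "\<And>t. \<bar>t\<bar> < e \<Longrightarrow>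
      a t * b t * c t + 2 * p t * q t * r t - a t * (r t)^2 - b t * (q t)^2 - c t * (p t)^2 = 1"
    and d1: "\<And>t. \<bar>t\<bar> < e \<Longrightarrow> (a has_real_derivative a' t) (at t)"
      "\<And>t. \<bar>t\<bar> < e \<Longrightarrow> (b has_real_derivative b' t) (at t)"
      "\<And>t. \<bar>t\<bar> < e \<Longrightarrow> (c has_real_derivative c' t) (at t)"
      "\<And>t. \<bar>t\<bar> < e \<Longrightarrow> (p has_real_derivative p' t) (at t)"
      "\<And>t. \<bar>t\<bar> < e \<Longrightarrow> (q has_real_derivative q' t) (at t)"
      "\<And>t. \<bar>t\<bar> < e \<Longrightarrow> (r has_real_derivative r' t) (at t)"
    and d2: "(a' has_real_derivative a'') (at 0)" "(b' has_real_derivative b'') (at 0)"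
      "(c' has_real_derivative c'') (at 0)" "(p' has_real_derivative p'') (at 0)"
      "(q' has_real_derivative q'') (at 0)" "(r' has_real_derivative r'') (at 0)"
    and diag: "p 0 = 0" "q 0 = 0" "r 0 = 0"
  shows "a' 0 / a 0 + b' 0 / b 0 + c' 0 / c 0 = 0" (is ?first)
    and "a'' / a 0 + b'' / b 0 + c'' / c 0
      = (a' 0)^2 / (a 0)^2 + (b' 0)^2 / (b 0)^2 + (c' 0)^2 / (c 0)^2
        + 2 * ((p' 0)^2 / (a 0 * b 0) + (q' 0)^2 / (a 0 * c 0) + (r' 0)^2 / (b 0 * c 0))" (is ?second)
proof -
  define g where "g t = a' t * b t * c t + a t * b' t * c t + a t * b t * c' t
    + 2 * (p' t * q t * r t + p t * q' t * r t + p t * q t * r' t)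
    - a' t * (r t)^2 - 2 * a t * r t * r' t
    - b' t * (q t)^2 - 2 * b t * q t * q' t
    - c' t * (p t)^2 - 2 * c t * p t * p' t" for t
  have nhd: "\<forall>\<^sub>F s in nhds t. \<bar>s\<bar> < e" if "\<bar>t\<bar> < e" for t
    using that by (intro eventually_nhds_in_open[of "{s. \<bar>s\<bar> < e}", simplified])
      (auto intro!: open_Collect_less continuous_intros)
  have g0: "g t = 0" if t: "\<bar>t\<bar> < e" for t
  proof -
    have "((\<lambda>t. a t * b t * c t + 2 * p t * q t * r t - a t * (r t)^2 - b t * (q t)^2 - c t * (p t)^2)
      has_real_derivative g t) (at t)"
      unfolding g_def using d1[OF t]
      by (auto intro!: derivative_eq_intros simp: power2_eq_square algebra_simps)
    then have "((\<lambda>t. 1) has_real_derivative g t) (at t)"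
      using nhd[OF t] det by (subst (asm) DERIV_cong_ev[OF refl _ refl]) (auto elim: eventually_mono)
    then show ?thesis
      using DERIV_unique DERIV_const by blast
  qed
  have d10: "(a has_real_derivative a' 0) (at 0)" "(b has_real_derivative b' 0) (at 0)"
    "(c has_real_derivative c' 0) (at 0)" "(p has_real_derivative p' 0) (at 0)"
    "(q has_real_derivative q' 0) (at 0)" "(r has_real_derivative r' 0) (at 0)"
    using d1[of 0] e by auto
  \<comment> \<open>\<open>G\<close> is the derivative of \<open>g\<close> at 0. As
    \<open>p\<close>, \<open>q\<close>, \<open>r\<close> vanish there, only the squares of their
    first derivatives survive.\<close>
  define G where "G = a'' * b 0 * c 0 + a 0 * b'' * c 0 + a 0 * b 0 * c''
    + 2 * (a' 0 * b' 0 * c 0 + a' 0 * b 0 * c' 0 + a 0 * b' 0 * c' 0)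
    - 2 * a 0 * (r' 0)^2 - 2 * b 0 * (q' 0)^2 - 2 * c 0 * (p' 0)^2"
  have "(g has_real_derivative G) (at 0)"
    unfolding g_def G_def using d10 d2 diag
    by (auto intro!: derivative_eq_intros simp: power2_eq_square algebra_simps)
  then have "((\<lambda>t. 0) has_real_derivative G) (at 0)"
    using nhd[of 0] e g0 by (subst (asm) DERIV_cong_ev[OF refl _ refl]) (auto elim: eventually_mono)
  then have G: "G = 0"
    using DERIV_unique DERIV_const by blast
  have abc: "a 0 * b 0 * c 0 = 1"
    using det[of 0] e diag by simp
  then have nz: "a 0 \<noteq> 0" "b 0 \<noteq> 0" "c 0 \<noteq> 0"
    by auto
  have "(a' 0 / a 0 + b' 0 / b 0 + c' 0 / c 0) * (a 0 * b 0 * c 0) = g 0"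
    using nz by (simp add: g_def diag field_simps)
  then show first: ?first
    using g0[of 0] e abc by simp
  \<comment> \<open>The three logarithmic derivatives sum to zero, so their mixed products can be
    traded for squares. This replaces mixed products of either sign by a nonnegative sum.\<close>
  have sq: "(a' 0)^2 / (a 0)^2 + (b' 0)^2 / (b 0)^2 + (c' 0)^2 / (c 0)^2
    = - 2 * (a' 0 / a 0 * (b' 0 / b 0) + a' 0 / a 0 * (c' 0 / c 0) + b' 0 / b 0 * (c' 0 / c 0))"
  proof -
    have "x^2 + y^2 + z^2 = - 2 * (x * y + x * z + y * z)" if "x + y + z = 0" for x y z :: real
    proof -
      have "x = - y - z" using that by simp
      then show ?thesis by (simp only:) (simp add: power2_eq_square algebra_simps)
    qed
    from this[OF first] show ?thesis by (simp add: power_divide)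
  qed
  have "(a'' / a 0 + b'' / b 0 + c'' / c 0
      + 2 * (a' 0 / a 0 * (b' 0 / b 0) + a' 0 / a 0 * (c' 0 / c 0) + b' 0 / b 0 * (c' 0 / c 0))
      - 2 * ((p' 0)^2 / (a 0 * b 0) + (q' 0)^2 / (a 0 * c 0) + (r' 0)^2 / (b 0 * c 0))) * (a 0 * b 0 * c 0) = G"
    using nz by (simp add: G_def field_simps power2_eq_square)
  then show ?second
    unfolding sq using G abc by simp
qed

section \<open>Eigenframes of the Hessian\<close>

text \<open>A maximiser \<open>q\<close> of the quadratic form on the unit sphere of
  \<open>V\<close> is an eigenvector. With \<open>z = \<mu> q - f q\<close>, the form
  \<open>\<mu> (v \<bullet> v) - f v \<bullet> v\<close> is nonnegative on \<open>V\<close> and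
  vanishes at \<open>q\<close>, while its derivative there along \<open>z\<close> is
  \<open>2 (z \<bullet> z)\<close>, which must therefore be 0.\<close>

lemma self_adjoint_max_eigenvector:
  fixes f :: "'a::euclidean_space \<Rightarrow> 'a"
  assumes f: "linear f" and V: "subspace V" "V \<noteq> {0}" "f ` V \<subseteq> V"
    and sym: "\<And>x y. f x \<bullet> y = x \<bullet> f y"
  obtains q \<mu> where "q \<in> V" "norm q = 1" "f q = \<mu> *\<^sub>R q" "\<And>v. v \<in> V \<Longrightarrow> f v \<bullet> v \<le> \<mu> * (v \<bullet> v)"
proof -
  obtain w where w: "w \<in> V" "w \<noteq> 0"
    using V subspace_0 by fastforce
  have "compact (sphere 0 1 \<inter> V)"
    by (intro compact_Int_closed closed_subspace V) auto
  moreover have "w /\<^sub>R norm w \<in> sphere 0 1 \<inter> V"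
    using w V by (auto simp: subspace_scale)
  moreover have "continuous_on (sphere 0 1 \<inter> V) (\<lambda>v. f v \<bullet> v)"
    by (intro continuous_intros linear_continuous_on linear_linear[THEN iffD2] f)
  ultimately obtain q where q: "q \<in> V" "norm q = 1"
    and max: "\<And>v. v \<in> V \<Longrightarrow> norm v = 1 \<Longrightarrow> f v \<bullet> v \<le> f q \<bullet> q"
    using continuous_attains_sup[of "sphere 0 1 \<inter> V" "\<lambda>v. f v \<bullet> v"] by (metis IntE IntI empty_iff mem_sphere_0)
  define \<mu> where "\<mu> = f q \<bullet> q"
  have le: "f v \<bullet> v \<le> \<mu> * (v \<bullet> v)" if "v \<in> V" for v
  proof (cases "v = 0")
    case True
    then show ?thesis by simp
  next
    case False
    have "f (v /\<^sub>R norm v) \<bullet> (v /\<^sub>R norm v) \<le> \<mu>"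
      unfolding \<mu>_def using that False V by (intro max) (auto simp: subspace_scale)
    then have "(f v \<bullet> v) / (norm v * norm v) \<le> \<mu>"
      by (simp add: linear_cmul[OF f] divide_inverse mult.commute mult.left_commute)
    then show ?thesis
      using False by (simp add: field_simps dot_square_norm power2_eq_square)
  qed
  define z where "z = \<mu> *\<^sub>R q - f q"
  have z: "z \<in> V"
    using V q by (auto simp: z_def intro!: subspace_diff subspace_scale)
  have qq: "q \<bullet> q = 1"
    using q by (simp add: dot_square_norm)
  have "0 \<le> 2 * t * (z \<bullet> z) + t^2 * (\<mu> * (z \<bullet> z) - f z \<bullet> z)" for t
  proof -
    have "q + t *\<^sub>R z \<in> V"
      using V q z by (auto intro!: subspace_add subspace_scale)
    from le[OF this] have "0 \<le> \<mu> * ((q + t *\<^sub>R z) \<bullet> (q + t *\<^sub>R z)) - f (q + t *\<^sub>R z) \<bullet> (q + t *\<^sub>R z)"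
      by simp
    also have "\<dots> = 2 * t * (\<mu> * (q \<bullet> z) - f q \<bullet> z) + t^2 * (\<mu> * (z \<bullet> z) - f z \<bullet> z)"
      using sym[of z q] qq \<mu>_def sym[of q q]
      by (simp add: linear_add[OF f] linear_cmul[OF f] inner_add power2_eq_square
          algebra_simps inner_commute)
    also have "\<mu> * (q \<bullet> z) - f q \<bullet> z = z \<bullet> z"
      by (simp add: z_def inner_diff algebra_simps)
    finally show ?thesis .
  qed
  note nonneg = this
  have "z \<bullet> z = 0"
  proof (rule ccontr)
    assume "z \<bullet> z \<noteq> 0"
    then have zz: "z \<bullet> z > 0" by simp
    define K where "K = \<mu> * (z \<bullet> z) - f z \<bullet> z"
    have K: "K \<ge> 0" using le[OF z] by (simp add: K_def)
    \<comment> \<open>A small negative \<open>t\<close> makes the linear term win. The denominator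
      is \<open>K + 1\<close> because \<open>K\<close> may be 0.\<close>
    define t where "t = - (z \<bullet> z) / (K + 1)"
    have t: "t * (K + 1) = - (z \<bullet> z)"
      using K by (simp add: t_def)
    have "(K + 1)^2 * (2 * t * (z \<bullet> z) + t^2 * K)
      = 2 * (t * (K + 1)) * (K + 1) * (z \<bullet> z) + (t * (K + 1))^2 * K"
      by (simp add: power2_eq_square algebra_simps)
    also have "\<dots> = - ((z \<bullet> z)^2 * (K + 2))"
      unfolding t by (simp add: power2_eq_square algebra_simps)
    also have "\<dots> < 0"
      using zz K by simp
    finally have "2 * t * (z \<bullet> z) + t^2 * K < 0"
      by (simp add: mult_less_0_iff)
    then show False
      using nonneg[of t] by (simp add: K_def)
  qed
  then have "f q = \<mu> *\<^sub>R q"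
    by (simp add: z_def)
  then show thesis
    using that q le by blast
qed

text \<open>Each eigenvector maximises the quadratic form on the orthogonal complement of the
  earlier ones. The complements shrink, so the eigenvalues come out in decreasing order.\<close>

lemma symmetric_matrix_eigenframe:
  fixes A :: "real ^ 3 ^ 3"
  assumes "transpose A = A"
  obtains Q :: "real ^ 3 ^ 3" and \<mu> :: "3 \<Rightarrow> real"
  where "orthogonal_matrix Q" "\<And>i. A *v column i Q = \<mu> i *\<^sub>R column i Q"
    "\<mu> 3 \<le> \<mu> 2" "\<mu> 2 \<le> \<mu> 1"
proof -
  define f where "f = (*v) A"
  have f: "linear f"
    by (simp add: f_def)
  have sym: "f x \<bullet> y = x \<bullet> f y" for x y
    unfolding f_def by (metis assms dot_lmul_matrix transpose_matrix_vector)
  have step: "\<exists>q \<mu>. (\<forall>b\<in>B. q \<bullet> b = 0) \<and> norm q = 1 \<and> f q = \<mu> *\<^sub>R q \<and>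
      (\<forall>v. (\<forall>b\<in>B. v \<bullet> b = 0) \<longrightarrow> f v \<bullet> v \<le> \<mu> * (v \<bullet> v))"
    if B: "finite B" "card B < 3" "\<And>b. b \<in> B \<Longrightarrow> \<exists>\<nu>. f b = \<nu> *\<^sub>R b" for B
  proof -
    define V where "V = {v. \<forall>b\<in>B. v \<bullet> b = 0}"
    have "subspace V"
      by (auto simp: V_def subspace_def inner_add)
    moreover have "V \<noteq> {0}"
    proof -
      have "dim B < DIM(real ^ 3)"
        using dim_le_card'[OF B(1)] B(2) by simp
      then obtain x where "x \<noteq> 0" "\<And>y. y \<in> span B \<Longrightarrow> orthogonal x y"
        using orthogonal_to_subspace_exists by blast
      then have "x \<in> V" by (auto simp: V_def orthogonal_def span_base)
      with \<open>x \<noteq> 0\<close> show ?thesis by auto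
    qed
    moreover have "f ` V \<subseteq> V"
      using B(3) by (fastforce simp: V_def sym)
    ultimately obtain q \<mu> where "q \<in> V" "norm q = 1" "f q = \<mu> *\<^sub>R q" "\<And>v. v \<in> V \<Longrightarrow> f v \<bullet> v \<le> \<mu> * (v \<bullet> v)"
      using self_adjoint_max_eigenvector[OF f _ _ _ sym] by blast
    then show ?thesis by (auto simp: V_def)
  qed
  obtain q1 m1 where q1: "norm q1 = 1" "f q1 = m1 *\<^sub>R q1" "\<And>v. f v \<bullet> v \<le> m1 * (v \<bullet> v)"
    using step[of "{}"] by auto
  obtain q2 m2 where q2: "q2 \<bullet> q1 = 0" "norm q2 = 1" "f q2 = m2 *\<^sub>R q2"
      "\<And>v. v \<bullet> q1 = 0 \<Longrightarrow> f v \<bullet> v \<le> m2 * (v \<bullet> v)"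
    using step[of "{q1}"] q1 by auto
  have "card {q1, q2} < 3"
    by (simp add: card_insert_if)
  then obtain q3 m3 where q3: "q3 \<bullet> q1 = 0" "q3 \<bullet> q2 = 0" "norm q3 = 1" "f q3 = m3 *\<^sub>R q3"
    using step[of "{q1, q2}"] q1 q2 by auto
  have norms: "q1 \<bullet> q1 = 1" "q2 \<bullet> q2 = 1" "q3 \<bullet> q3 = 1"
    using q1 q2 q3 by (simp_all add: dot_square_norm)
  define q :: "3 \<Rightarrow> real ^ 3" where "q i = (if i = 1 then q1 else if i = 2 then q2 else q3)" for i
  define \<mu> :: "3 \<Rightarrow> real" where "\<mu> i = (if i = 1 then m1 else if i = 2 then m2 else m3)" for i
  define Q :: "real ^ 3 ^ 3" where "Q = (\<chi> i j. q j $ i)"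
  have col: "column i Q = q i" for i
    by (simp add: column_def Q_def vec_eq_iff)
  have "orthogonal_matrix Q"
    unfolding orthogonal_matrix_orthonormal_columns col forall_3
    using q1 q2 q3 by (simp add: q_def orthogonal_def inner_commute)
  moreover have "A *v column i Q = \<mu> i *\<^sub>R column i Q" for i
    unfolding col using q1 q2 q3 by (auto simp: q_def \<mu>_def f_def)
  moreover have "\<mu> 2 \<le> \<mu> 1"
    using q1(3)[of q2] q2 norms by (simp add: \<mu>_def)
  moreover have "\<mu> 3 \<le> \<mu> 2"
    using q2(4)[of q3] q3 norms by (simp add: \<mu>_def)
  ultimately show thesis
    using that by blast
qed

section \<open>Characteristic polynomials in dimension three\<close>

lemma det_mat_minus_3:
  fixes A :: "real ^ 3 ^ 3"
  shows "det (mat t - A) = (t - A$1$1) * (t - A$2$2) * (t - A$3$3)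
    - A$1$2 * A$2$3 * A$3$1 - A$1$3 * A$2$1 * A$3$2
    - (t - A$1$1) * A$2$3 * A$3$2 - A$1$2 * A$2$1 * (t - A$3$3) - A$1$3 * (t - A$2$2) * A$3$1"
  by (simp add: det_3 mat_def algebra_simps)

lemma prod_UNIV_3: "(\<Prod>i\<in>UNIV. f i) = f 1 * f 2 * f (3::3)"
  unfolding UNIV_3 by (simp add: mult.assoc)

lemma eigenvalues_trace_3:
  fixes A :: "real ^ 3 ^ 3"
  assumes "is_eigenvalues A l"
  shows "A$1$1 + A$2$2 + A$3$3 = l$1 + l$2 + l$3"
proof -
  have eq: "det (mat t - A) = (t - l$1) * (t - l$2) * (t - l$3)" for t
    using assms by (simp add: is_eigenvalues_def prod_UNIV_3)
  \<comment> \<open>For the characteristic polynomial \<open>p\<close>, the combination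
    \<open>p(1) + p(-1) - 2 p(0)\<close> isolates the coefficient of \<open>t^2\<close>; it is minus
    twice the trace.\<close>
  from eq[of 0] eq[of 1] eq[of "-1"] show ?thesis
    unfolding det_mat_minus_3 by (simp add: algebra_simps)
qed

lemma eigenvalues_orthogonal_conjugate:
  fixes A Q :: "real ^ 'n ^ 'n"
  assumes "is_eigenvalues A l" "orthogonal_matrix Q"
  shows "is_eigenvalues (transpose Q ** A ** Q) l"
  unfolding is_eigenvalues_def
proof
  fix t
  have Q: "transpose Q ** Q = mat 1"
    using assms(2) by (simp add: orthogonal_matrix_def)
  have "(\<Sum>k\<in>UNIV. Q $ k $ i * mat t $ k $ l) = t * Q $ l $ i" for i l
    by (simp add: mat_def if_distrib[of "\<lambda>x. _ * x"] cong: if_cong)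
  then have "transpose Q ** mat t ** Q = (\<chi> i j. t * (transpose Q ** Q) $ i $ j)"
    by (simp add: matrix_matrix_mult_def transpose_def vec_eq_iff sum_distrib_left mult.assoc)
  also have "\<dots> = mat t"
    unfolding Q by (simp add: mat_def vec_eq_iff)
  finally have t: "transpose Q ** mat t ** Q = mat t" .
  have "X ** (B - C) = X ** B - X ** C" "(B - C) ** X = B ** X - C ** X" for X B C :: "real ^ 'n ^ 'n"
    by (simp_all add: matrix_matrix_mult_def vec_eq_iff sum_subtractf algebra_simps)
  then have "mat t - transpose Q ** A ** Q = transpose Q ** (mat t - A) ** Q"
    by (simp add: t)
  then have "det (mat t - transpose Q ** A ** Q) = det (transpose Q ** Q) * det (mat t - A)"
    by (simp add: det_mul)
  then show "det (mat t - transpose Q ** A ** Q) = (\<Prod>i\<in>UNIV. t - l $ i)"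
    using assms(1) by (simp add: Q is_eigenvalues_def)
qed

text \<open>The entries of \<open>l\<close> come in an unknown order, and no matching permutation is
  constructed. Since both lists are the roots of one polynomial, \<open>A$1$1\<close> is some entry
  of \<open>l\<close>, and the trace makes \<open>A$2$2 + A$3$3\<close> the sum of the other two.
  For the second claim, which amounts to \<open>A$1$1 + 2 * A$3$3 \<ge> 0\<close>, comparing the
  extreme entries suffices.\<close>

lemma P2_half_ordered_diagonal:
  fixes A :: "real ^ 3 ^ 3"
  assumes ev: "is_eigenvalues A l" "l \<in> P2_half"
    and diag: "\<And>i j. i \<noteq> j \<Longrightarrow> A $ i $ j = 0"
    and ord: "A$3$3 \<le> A$2$2" "A$2$2 \<le> A$1$1"
  shows "0 < A$2$2 + A$3$3" "A$1$1 + A$2$2 \<le> (A$2$2 + A$3$3) + 3 * (A$1$1 + A$3$3)"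
proof -
  have pos: "l$1 + l$2 > 0" "l$1 + l$3 > 0" "l$2 + l$3 > 0"
    using ev(2) by (simp_all add: P2_half_def)
  have half: "- (1/2) * Max (range (\<lambda>i. l $ i)) \<le> Min (range (\<lambda>i. l $ i))"
    using ev(2) by (simp add: P2_half_def)
  have eq: "(t - A$1$1) * (t - A$2$2) * (t - A$3$3) = (t - l$1) * (t - l$2) * (t - l$3)" for t
    using ev(1) det_mat_minus_3[of t A] diag by (simp add: is_eigenvalues_def prod_UNIV_3)
  have "(A$1$1 - l$1) * (A$1$1 - l$2) * (A$1$1 - l$3) = 0"
    using eq[of "A$1$1"] by simp
  then show "0 < A$2$2 + A$3$3"
    using eigenvalues_trace_3[OF ev(1)] pos by auto
  have "(A$3$3 - l$1) * (A$3$3 - l$2) * (A$3$3 - l$3) = 0"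
    using eq[of "A$3$3"] by simp
  then have "A$3$3 \<in> range (\<lambda>i. l $ i)"
    by auto
  then have min: "Min (range (\<lambda>i. l $ i)) \<le> A$3$3"
    by (intro Min_le) auto
  have "l $ i \<le> A$1$1" for i
  proof -
    have "(l$i - l$1) * (l$i - l$2) * (l$i - l$3) = 0"
      using exhaust_3[of i] by auto
    then show ?thesis
      using eq[of "l$i"] ord by auto
  qed
  then have max: "Max (range (\<lambda>i. l $ i)) \<le> A$1$1"
    by (intro Max.boundedI) auto
  show "A$1$1 + A$2$2 \<le> (A$2$2 + A$3$3) + 3 * (A$1$1 + A$3$3)"
    using min max half by argo
qed

section \<open>Hessian and Laplacian in a frame\<close>

lemma hessian_in_frame:
  fixes u :: "real ^ 'n \<Rightarrow> real" and Q :: "real ^ 'n ^ 'n"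
  assumes S: "open S" "x \<in> S" and u: "Ck_on (Suc (Suc k)) u S"
  shows "dderiv (column i Q) (dderiv (column j Q) u) x = (transpose Q ** hessian u x ** Q) $ i $ j"
proof -
  have d: "u differentiable (at y)" "dderiv v u differentiable (at y)" if "y \<in> S" for y v
    using u that by auto
  have "dderiv (column i Q) (dderiv (column j Q) u) x
      = dderiv (column i Q) (\<lambda>y. \<Sum>l\<in>UNIV. column j Q $ l * dderiv (axis l 1) u y) x"
    by (rule dderiv_cong[OF S]) (rule dderiv_expand[OF d(1)])
  also have "\<dots> = (\<Sum>l\<in>UNIV. column j Q $ l * dderiv (column i Q) (dderiv (axis l 1) u) x)"
    by (rule dderiv_lincomb) (use d(2) S in auto)
  also have "\<dots> = (\<Sum>l\<in>UNIV. column j Q $ l *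
      (\<Sum>k\<in>UNIV. column i Q $ k * dderiv (axis k 1) (dderiv (axis l 1) u) x))"
    by (intro sum.cong refl arg_cong2[where f = "(*)"] dderiv_expand d(2) S(2))
  also have "\<dots> = (transpose Q ** hessian u x ** Q) $ i $ j"
    by (simp add: matrix_matrix_mult_def transpose_def column_def hessian_def partial_deriv_def[abs_def]
        mult.commute)
  finally show ?thesis .
qed

lemma hessian_symmetric:
  fixes u :: "real ^ 'n \<Rightarrow> real"
  assumes "open S" "x \<in> S" "Ck_on (Suc (Suc k)) u S"
  shows "transpose (hessian u x) = hessian u x"
  unfolding transpose_def hessian_def partial_deriv_def[abs_def] vec_eq_iff
  using dderiv_commute[OF assms] by simp

lemma laplacian_eq_trace_3:
  fixes u :: "real ^ 3 \<Rightarrow> real"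
  shows "laplacian u x = hessian u x $ 1 $ 1 + hessian u x $ 2 $ 2 + hessian u x $ 3 $ 3"
  by (simp add: laplacian_def hessian_def sum_3)

lemma laplacian_eigenvalues:
  fixes u :: "real ^ 3 \<Rightarrow> real"
  assumes "is_eigenvalues (hessian u x) l"
  shows "laplacian u x = l$1 + l$2 + l$3"
  using eigenvalues_trace_3[OF assms] by (simp add: laplacian_eq_trace_3)

lemma laplacian_pos:
  fixes u :: "real ^ 3 \<Rightarrow> real"
  assumes "is_eigenvalues (hessian u x) l" "l \<in> P2_half"
  shows "0 < laplacian u x"
proof -
  have "l$1 + l$2 > 0" "l$1 + l$3 > 0" "l$2 + l$3 > 0"
    using assms(2) by (simp_all add: P2_half_def)
  then show ?thesis
    unfolding laplacian_eigenvalues[OF assms(1)] by linarith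
qed

text \<open>\<open>E1\<close> and \<open>E2\<close> are the first and second order conditions, in
  one frame direction, at a maximum of \<open>20 ln w + ln S + a |x - c|^2 / 2\<close>.
  \<open>E1\<close> eliminates the derivative \<open>U\<close> of \<open>u\<close>: the weight 20
  leaves only \<open>1/10\<close> of \<open>S1^2 / S^2\<close>, to match the factor
  \<open>11/10\<close> of the Jacobi inequality, and \<open>a = 5 / d^2\<close> makes the remaining
  error at most half of \<open>a\<close>.\<close>

lemma log_second_derivative_bound:
  fixes w S U Z S1 S2 m a d :: real
  assumes w: "0 < w" and S: "0 < S" and d: "0 < d" "Z^2 \<le> d^2" and a: "a = 5 / d^2"
    and E1: "- 20 * U / w + S1 / S + a * Z = 0"
    and E2: "- 20 * m / w - 20 * U^2 / w^2 + S2 / S - S1^2 / S^2 + a \<le> 0"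
  shows "S2 / S \<le> 20 * m / w + 11/10 * (S1^2 / S^2) - a / 2"
proof -
  have U: "20 * (U / w) = S1 / S + a * Z"
    using E1 by simp
  have "20 * U^2 / w^2 = 1/20 * (20 * (U / w))^2"
    by (simp add: power_divide power_mult_distrib)
  also have "\<dots> = 1/20 * (S1 / S + a * Z)^2"
    unfolding U ..
  also have "\<dots> \<le> 1/20 * (2 * (S1 / S)^2 + 2 * (a * Z)^2)"
    using sum_squares_bound[of "S1 / S" "a * Z"] by (simp add: power2_sum)
  also have "\<dots> = 1/10 * (S1^2 / S^2) + 1/10 * (a^2 * Z^2)"
    by (simp add: power_divide power_mult_distrib)
  also have "a^2 * Z^2 \<le> a^2 * d^2"
    using d by (intro mult_left_mono) auto
  also have "a^2 * d^2 = 5 * a"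
    using d by (simp add: a power2_eq_square)
  finally have "20 * U^2 / w^2 \<le> 1/10 * (S1^2 / S^2) + 1/2 * a"
    by simp
  then show ?thesis
    using E2 by argo
qed

section \<open>The interior maximum\<close>

text \<open>The second order conditions at the maximum, weighted with the coefficients of the
  linearised operator, meet the Jacobi inequality: the squares of the gradient of the Laplacian
  cancel, and what remains bounds \<open>S^2 * w\<close>.\<close>

lemma interior_maximum_bound:
  fixes u :: "real ^ 3 \<Rightarrow> real" and ev :: "real ^ 3 \<Rightarrow> real ^ 3"
  assumes \<Omega>: "open \<Omega>" and u: "Ck_on 4 u \<Omega>"
    and ev: "\<And>x. x \<in> \<Omega> \<Longrightarrow> is_eigenvalues (hessian u x) (ev x)" "\<And>x. x \<in> \<Omega> \<Longrightarrow> ev x \<in> P2_half"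
    and eq: "\<And>x. x \<in> \<Omega> \<Longrightarrow> (ev x $ 1 + ev x $ 2) * (ev x $ 1 + ev x $ 3) * (ev x $ 2 + ev x $ 3) = 1"
    and r: "0 < r" "ball x0 r \<subseteq> \<Omega>" "\<And>x. x \<in> ball x0 r \<Longrightarrow> u x < \<kappa>"
    and d: "0 < d" "norm (x0 - c) \<le> d" and a: "a = 5 / d^2"
    and max: "\<And>x. x \<in> ball x0 r \<Longrightarrow>
      20 * ln (\<kappa> - u x) + ln (laplacian u x) + a / 2 * (norm (x - c))^2
      \<le> 20 * ln (\<kappa> - u x0) + ln (laplacian u x0) + a / 2 * (norm (x0 - c))^2"
    and large: "11 \<le> laplacian u x0"
  shows "(laplacian u x0)^2 * (\<kappa> - u x0) \<le> 108 * d^2"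
proof -
  have x0: "x0 \<in> \<Omega>" using r by auto
  have u4: "Ck_on (Suc (Suc (Suc (Suc 0)))) u \<Omega>"
    using u by (simp only: eval_nat_numeral BitM.simps numeral_One One_nat_def)
  \<comment> \<open>The frame diagonalises the Hessian at \<open>x0\<close> and stays constant near
    it, so the \<open>h i j\<close> below are derivatives in fixed directions and form a diagonal
    matrix at \<open>x0\<close>.\<close>
  obtain Q \<mu> where Q: "orthogonal_matrix Q"
    and \<mu>: "\<And>i. hessian u x0 *v column i Q = \<mu> i *\<^sub>R column i Q" "\<mu> 3 \<le> \<mu> 2" "\<mu> 2 \<le> \<mu> 1"
    using symmetric_matrix_eigenframe[OF hessian_symmetric[OF \<Omega> x0 u4]] by metis
  define q where "q i = column i Q" for i
  have orth: "q i \<bullet> q j = (if i = j then 1 else 0)" for i j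
    using Q unfolding orthogonal_matrix_orthonormal_columns q_def
    by (auto simp: orthogonal_def dot_square_norm)
  define H where "H x = transpose Q ** hessian u x ** Q" for x
  define h where "h i j = dderiv (q i) (dderiv (q j) u)" for i j
  have hH: "h i j x = H x $ i $ j" if "x \<in> \<Omega>" for i j x
    unfolding h_def H_def q_def by (rule hessian_in_frame[OF \<Omega> that u4])
  have evH: "is_eigenvalues (H x) (ev x)" if "x \<in> \<Omega>" for x
    unfolding H_def by (rule eigenvalues_orthogonal_conjugate[OF ev(1)[OF that] Q])
  have Ck: "Ck_on (Suc (Suc (Suc 0))) (dderiv (q i) u) \<Omega>" "Ck_on (Suc (Suc 0)) (h i j) \<Omega>"
    "Ck_on (Suc 0) (dderiv (q m) (h i j)) \<Omega>" for i j m
    using u4 unfolding h_def by (blast intro: Ck_on_dderiv)+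
  have hsym: "h i j x = h j i x" if "x \<in> \<Omega>" for i j x
    unfolding h_def by (rule dderiv_commute[OF \<Omega> that u4])
  have lap: "laplacian u x = h 1 1 x + h 2 2 x + h 3 3 x" if "x \<in> \<Omega>" for x
    using laplacian_eigenvalues[OF ev(1)[OF that]] eigenvalues_trace_3[OF evH[OF that]] that
    by (simp add: hH)
  \<comment> \<open>The characteristic polynomial evaluated at the trace is the product of the
    pairwise sums. This puts the equation in terms of the entries \<open>h i j\<close>, which can be
    differentiated even where eigenvalues collide.\<close>
  have det: "(h 2 2 x + h 3 3 x) * (h 1 1 x + h 3 3 x) * (h 1 1 x + h 2 2 x)
      + 2 * (- h 1 2 x) * (- h 1 3 x) * (- h 2 3 x)
      - (h 2 2 x + h 3 3 x) * (- h 2 3 x)^2 - (h 1 1 x + h 3 3 x) * (- h 1 3 x)^2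
      - (h 1 1 x + h 2 2 x) * (- h 1 2 x)^2 = 1" if x: "x \<in> \<Omega>" for x
  proof -
    have "det (mat (ev x $ 1 + ev x $ 2 + ev x $ 3) - H x) = 1"
      using evH[OF x] eq[OF x] by (simp add: is_eigenvalues_def prod_UNIV_3 mult_ac add_ac)
    then show ?thesis
      unfolding eigenvalues_trace_3[OF evH[OF x], symmetric] det_mat_minus_3
      using hsym[OF x, of 2 1] hsym[OF x, of 3 1] hsym[OF x, of 3 2]
      by (simp add: hH[OF x, symmetric] power2_eq_square algebra_simps)
  qed
  have diag: "h i j x0 = (if i = j then \<mu> i else 0)" for i j
  proof -
    have "H x0 $ i $ j = q i \<bullet> (hessian u x0 *v q j)"
      by (simp add: H_def q_def matrix_matrix_mult_def transpose_def column_def inner_vec_def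
          matrix_vector_mult_def sum_3 algebra_simps)
    then show ?thesis
      using orth[of i j] x0 \<mu>(1)[of j] by (simp add: hH q_def)
  qed

  define S where "S = laplacian u x0"
  define w where "w = \<kappa> - u x0"
  define b1 b2 b3 where "b1 = \<mu> 2 + \<mu> 3" and "b2 = \<mu> 1 + \<mu> 3" and "b3 = \<mu> 1 + \<mu> 2"
  have b: "0 < b1" "b1 \<le> b2" "b2 \<le> b3" "b3 \<le> b1 + 3 * b2"
    using P2_half_ordered_diagonal[OF evH[OF x0] ev(2)[OF x0]] \<mu>(2,3)
    by (simp_all add: hH[OF x0, symmetric] diag b1_def b2_def b3_def)
  have S: "S = (b1 + b2 + b3) / 2" "11 \<le> S"
    using lap[OF x0] large by (simp_all add: S_def diag b1_def b2_def b3_def)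
  have b123: "b1 * b2 * b3 = 1"
    using det[OF x0] by (simp add: diag b1_def b2_def b3_def)
  note gap = eigenvalue_gap[OF b(1-3) b123 S b(4)]
  have bpos: "0 < b2" "0 < b3" "0 < S" "0 < w"
    using b S r(1) r(3)[of x0] by (auto simp: w_def)

  define T where "T m i j = dderiv (q m) (h i j) x0" for m i j
  define F where "F m i j = dderiv (q m) (dderiv (q m) (h i j)) x0" for m i j
  have Tsym: "T m i j = T m j i" "T m i j = T i m j" for m i j
  proof -
    show "T m i j = T m j i"
      unfolding T_def by (rule dderiv_cong[OF \<Omega> x0 hsym])
    show "T m i j = T i m j"
      unfolding T_def h_def by (rule dderiv_commute[OF \<Omega> x0 Ck(1)])
  qed
  have Fsym: "F m i i = F i m m" for m i
  proof -
    have "F m i i = dderiv (q m) (dderiv (q i) (h m i)) x0"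
      unfolding F_def h_def by (rule dderiv_cong[OF \<Omega> x0]) (rule dderiv_commute[OF \<Omega> _ Ck(1)])
    also have "\<dots> = dderiv (q i) (dderiv (q m) (h m i)) x0"
      by (rule dderiv_commute[OF \<Omega> x0 Ck(2)])
    also have "\<dots> = dderiv (q i) (dderiv (q m) (h i m)) x0"
      by (rule dderiv_cong[OF \<Omega> x0]) (rule dderiv_cong[OF \<Omega> _ hsym])
    also have "\<dots> = F i m m"
      unfolding F_def h_def by (rule dderiv_cong[OF \<Omega> x0]) (rule dderiv_commute[OF \<Omega> _ Ck(1)])
    finally show ?thesis .
  qed

  have line: "x0 + t *\<^sub>R q m \<in> ball x0 r" "x0 + t *\<^sub>R q m \<in> \<Omega>" if "\<bar>t\<bar> < r" for t m
  proof -
    show 1: "x0 + t *\<^sub>R q m \<in> ball x0 r"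
      using that orth[of m m] by (simp add: dist_norm norm_eq_sqrt_inner)
    show "x0 + t *\<^sub>R q m \<in> \<Omega>"
      using 1 r(2) by blast
  qed
  have du: "((\<lambda>t. u (x0 + t *\<^sub>R q m)) has_real_derivative dderiv (q m) u (x0 + t *\<^sub>R q m)) (at t)"
    and ddu: "((\<lambda>t. dderiv (q m) u (x0 + t *\<^sub>R q m)) has_real_derivative h m m (x0 + t *\<^sub>R q m)) (at t)"
    and dh: "((\<lambda>t. h i j (x0 + t *\<^sub>R q m)) has_real_derivative dderiv (q m) (h i j) (x0 + t *\<^sub>R q m)) (at t)"
    and ddh: "((\<lambda>t. dderiv (q m) (h i j) (x0 + t *\<^sub>R q m)) has_real_derivative
        dderiv (q m) (dderiv (q m) (h i j)) (x0 + t *\<^sub>R q m)) (at t)"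
    if "\<bar>t\<bar> < r" for t m i j
    unfolding h_def using u4 Ck(1)[of m] Ck(2,3) line(2)[OF that, of m]
    by (auto intro!: has_real_derivative_line simp: h_def)
  have ddh0: "((\<lambda>t. dderiv (q m) (h i j) (x0 + t *\<^sub>R q m)) has_real_derivative F m i j) (at 0)" for m i j
    using ddh[where t = 0 and m = m and i = i and j = j] r(1) by (simp add: F_def)

  have second: "(T m 2 2 + T m 3 3) / b1 + (T m 1 1 + T m 3 3) / b2 + (T m 1 1 + T m 2 2) / b3 = 0"
    "(F m 2 2 + F m 3 3) / b1 + (F m 1 1 + F m 3 3) / b2 + (F m 1 1 + F m 2 2) / b3
      = (T m 2 2 + T m 3 3)^2 / b1^2 + (T m 1 1 + T m 3 3)^2 / b2^2 + (T m 1 1 + T m 2 2)^2 / b3^2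
      + 2 * ((T m 1 2)^2 / (b1 * b2) + (T m 1 3)^2 / (b1 * b3) + (T m 2 3)^2 / (b2 * b3))" for m
  proof -
    let ?l = "\<lambda>i j t. h i j (x0 + t *\<^sub>R q m)" and ?l' = "\<lambda>i j t. dderiv (q m) (h i j) (x0 + t *\<^sub>R q m)"
    note D = det3_second_derivative[OF r(1), of
        "\<lambda>t. ?l 2 2 t + ?l 3 3 t" "\<lambda>t. ?l 1 1 t + ?l 3 3 t" "\<lambda>t. ?l 1 1 t + ?l 2 2 t"
        "\<lambda>t. - ?l 1 2 t" "\<lambda>t. - ?l 1 3 t" "\<lambda>t. - ?l 2 3 t"
        "\<lambda>t. ?l' 2 2 t + ?l' 3 3 t" "\<lambda>t. ?l' 1 1 t + ?l' 3 3 t" "\<lambda>t. ?l' 1 1 t + ?l' 2 2 t"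
        "\<lambda>t. - ?l' 1 2 t" "\<lambda>t. - ?l' 1 3 t" "\<lambda>t. - ?l' 2 3 t",
        OF det[OF line(2)] DERIV_add[OF dh dh] DERIV_add[OF dh dh] DERIV_add[OF dh dh]
        DERIV_minus[OF dh] DERIV_minus[OF dh] DERIV_minus[OF dh]
        DERIV_add[OF ddh0 ddh0] DERIV_add[OF ddh0 ddh0] DERIV_add[OF ddh0 ddh0]
        DERIV_minus[OF ddh0] DERIV_minus[OF ddh0] DERIV_minus[OF ddh0]]
    show "(T m 2 2 + T m 3 3) / b1 + (T m 1 1 + T m 3 3) / b2 + (T m 1 1 + T m 2 2) / b3 = 0"
      using D(1) by (simp add: diag T_def b1_def b2_def b3_def)
    show "(F m 2 2 + F m 3 3) / b1 + (F m 1 1 + F m 3 3) / b2 + (F m 1 1 + F m 2 2) / b3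
      = (T m 2 2 + T m 3 3)^2 / b1^2 + (T m 1 1 + T m 3 3)^2 / b2^2 + (T m 1 1 + T m 2 2)^2 / b3^2
      + 2 * ((T m 1 2)^2 / (b1 * b2) + (T m 1 3)^2 / (b1 * b3) + (T m 2 3)^2 / (b2 * b3))"
      using D(2) by (simp add: diag T_def b1_def b2_def b3_def)
  qed

  define S1 where "S1 m = T m 1 1 + T m 2 2 + T m 3 3" for m
  define S2 where "S2 m = F m 1 1 + F m 2 2 + F m 3 3" for m
  define f1 f2 f3 where "f1 = 1/b2 + 1/b3" and "f2 = 1/b1 + 1/b3" and "f3 = 1/b1 + 1/b2"
  have fpos: "0 < f1" "0 < f2" "0 < f3"
    using b bpos by (auto simp: f1_def f2_def f3_def intro!: add_pos_pos)

  have jacobi: "11/10 * (f1 * (S1 1)^2 + f2 * (S1 2)^2 + f3 * (S1 3)^2) / S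
    \<le> f1 * S2 1 + f2 * S2 2 + f3 * S2 3"
  proof -
    \<comment> \<open>By \<open>Fsym\<close>, the linearised operator applied to the Laplacian
      becomes the sum over the frame of the left-hand sides in \<open>second(2)\<close>.\<close>
    have sum: "f1 * S2 1 + f2 * S2 2 + f3 * S2 3
      = ((F 1 2 2 + F 1 3 3) / b1 + (F 1 1 1 + F 1 3 3) / b2 + (F 1 1 1 + F 1 2 2) / b3)
      + ((F 2 2 2 + F 2 3 3) / b1 + (F 2 1 1 + F 2 3 3) / b2 + (F 2 1 1 + F 2 2 2) / b3)
      + ((F 3 2 2 + F 3 3 3) / b1 + (F 3 1 1 + F 3 3 3) / b2 + (F 3 1 1 + F 3 2 2) / b3)"
      using Fsym[of 2 1] Fsym[of 3 1] Fsym[of 3 2]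
      by (simp add: S2_def f1_def f2_def f3_def add_divide_distrib algebra_simps)
    have perm: "T 2 1 1 = T 1 1 2" "T 1 2 1 = T 1 1 2" "T 3 1 1 = T 1 1 3" "T 1 3 1 = T 1 1 3"
      "T 2 1 2 = T 1 2 2" "T 2 2 1 = T 1 2 2" "T 3 1 3 = T 1 3 3" "T 3 3 1 = T 1 3 3"
      "T 3 2 2 = T 2 2 3" "T 2 3 2 = T 2 2 3" "T 3 2 3 = T 2 3 3" "T 3 3 2 = T 2 3 3"
      "T 2 1 3 = T 1 2 3" "T 3 1 2 = T 1 2 3"
      using Tsym by metis+
    show ?thesis
      unfolding sum second(2)
      using jacobi_inequality[OF b(1) gap(1) b(3) S(1) gap(2),
          of "S1 1" "T 1 1 1" "T 1 2 2" "T 1 3 3" "S1 2" "T 1 1 2" "T 2 2 2" "T 2 3 3"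
          "S1 3" "T 1 1 3" "T 2 2 3" "T 3 3 3" "T 1 2 3"] second(1)[of 1]
      by (simp add: S1_def perm f1_def f2_def f3_def add_ac)
  qed

  have log: "S2 m / S \<le> 20 * \<mu> m / w + 11/10 * ((S1 m)^2 / S^2) - a / 2" for m
  proof -
    define U where "U = dderiv (q m) u"
    define z where "z = x0 - c"
    define L where "L t = h 1 1 (x0 + t *\<^sub>R q m) + h 2 2 (x0 + t *\<^sub>R q m) + h 3 3 (x0 + t *\<^sub>R q m)" for t
    define L' where "L' t = dderiv (q m) (h 1 1) (x0 + t *\<^sub>R q m) + dderiv (q m) (h 2 2) (x0 + t *\<^sub>R q m)
      + dderiv (q m) (h 3 3) (x0 + t *\<^sub>R q m)" for t
    define \<phi> where "\<phi> t = 20 * ln (\<kappa> - u (x0 + t *\<^sub>R q m)) + ln (L t) + a / 2 * (z \<bullet> z + 2 * t * (z \<bullet> q m) + t^2)" for t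
    define \<phi>' where "\<phi>' t = - 20 * U (x0 + t *\<^sub>R q m) / (\<kappa> - u (x0 + t *\<^sub>R q m)) + L' t / L t
      + a * (z \<bullet> q m + t)" for t
    have lapL: "laplacian u (x0 + t *\<^sub>R q m) = L t" if "\<bar>t\<bar> < r" for t
      using lap[OF line(2)[OF that]] by (simp add: L_def)
    have Lpos: "0 < L t" if "\<bar>t\<bar> < r" for t
      using laplacian_pos[OF ev(1)[OF line(2)[OF that, of m]] ev(2)[OF line(2)[OF that, of m]]] lapL[OF that]
      by simp
    have wpos: "0 < \<kappa> - u (x0 + t *\<^sub>R q m)" if "\<bar>t\<bar> < r" for t
      using r(3)[OF line(1)[OF that]] by simp
    have dL: "(L has_real_derivative L' t) (at t)" if "\<bar>t\<bar> < r" for t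
      unfolding L_def L'_def by (intro DERIV_add dh that)
    have dL': "(L' has_real_derivative S2 m) (at 0)"
      unfolding L'_def S2_def by (intro DERIV_add ddh0)
    have d1: "(\<phi> has_real_derivative \<phi>' t) (at t)" if t: "\<bar>t\<bar> < r" for t
      unfolding \<phi>_def \<phi>'_def U_def
      by (rule derivative_eq_intros du[OF t] dL[OF t] refl Lpos[OF t] wpos[OF t])+
        (simp add: field_simps)
    have zero: "L 0 = S" "L' 0 = S1 m"
      using lapL[of 0] r(1) by (simp_all add: S_def L'_def S1_def T_def)
    have d2: "(\<phi>' has_real_derivative
        - 20 * \<mu> m / w - 20 * (U x0)^2 / w^2 + S2 m / S - (S1 m)^2 / S^2 + a) (at 0)"
    proof -
      have U: "((\<lambda>t. U (x0 + t *\<^sub>R q m)) has_real_derivative \<mu> m) (at 0)"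
        using ddu[where t = 0 and m = m] r(1) by (simp add: U_def diag)
      define W where "W t = \<kappa> - u (x0 + t *\<^sub>R q m)" for t
      have "((\<lambda>t. u (x0 + t *\<^sub>R q m)) has_real_derivative U x0) (at 0)"
        using du[where t = 0 and m = m] r(1) by (simp add: U_def)
      then have dW: "(W has_real_derivative - U x0) (at 0)"
        unfolding W_def by (auto intro!: derivative_eq_intros)
      have W0: "W 0 = w"
        by (simp add: W_def w_def)
      have dL0: "(L has_real_derivative S1 m) (at 0)"
        using dL[of 0] r(1) zero by simp
      show ?thesis
        unfolding \<phi>'_def W_def[symmetric] using bpos
        by (auto intro!: derivative_eq_intros U dW dL0 dL' simp: zero W0 field_simps power2_eq_square)
    qed
    have "\<phi> t \<le> \<phi> 0" if t: "\<bar>t\<bar> < r" for t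
    proof -
      have "(norm (x0 + t *\<^sub>R q m - c))^2 = z \<bullet> z + 2 * t * (z \<bullet> q m) + t^2"
        using orth[of m m] unfolding power2_norm_eq_inner z_def
        by (simp add: inner_diff inner_add inner_commute power2_eq_square algebra_simps)
      moreover have "(norm (x0 - c))^2 = z \<bullet> z"
        unfolding power2_norm_eq_inner z_def ..
      ultimately show ?thesis
        using max[OF line(1)[OF t, of m]] lapL[OF t] zero by (simp add: \<phi>_def S_def)
    qed
    from second_derivative_test[OF r(1) d1 d2 this]
    have E: "- 20 * U x0 / w + S1 m / S + a * (z \<bullet> q m) = 0"
      "- 20 * \<mu> m / w - 20 * (U x0)^2 / w^2 + S2 m / S - (S1 m)^2 / S^2 + a \<le> 0"
      by (simp_all add: \<phi>'_def zero w_def)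
    have "\<bar>z \<bullet> q m\<bar> \<le> norm z * norm (q m)"
      by (rule Cauchy_Schwarz_ineq2)
    also have "\<dots> \<le> d"
      using d orth[of m m] by (simp add: z_def norm_eq_sqrt_inner)
    finally have "(z \<bullet> q m)^2 \<le> d^2"
      using d by (simp add: abs_le_square_iff[symmetric])
    then show ?thesis
      using log_second_derivative_bound[OF bpos(4,3) d(1) _ a E] by simp
  qed

  \<comment> \<open>This is Euler's identity for an equation of degree 3: the sum regroups into
    \<open>b1/b1 + b2/b2 + b3/b3\<close>.\<close>
  have "f1 * \<mu> 1 + f2 * \<mu> 2 + f3 * \<mu> 3 = 3"
  proof -
    have "f1 * \<mu> 1 + f2 * \<mu> 2 + f3 * \<mu> 3
        = (\<mu> 2 + \<mu> 3) * (1/b1) + (\<mu> 1 + \<mu> 3) * (1/b2) + (\<mu> 1 + \<mu> 2) * (1/b3)"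
      unfolding f1_def f2_def f3_def by (simp only: algebra_simps)
    then show ?thesis
      using b bpos by (simp flip: b1_def b2_def b3_def)
  qed
  have "f1 * (S2 1 / S) + f2 * (S2 2 / S) + f3 * (S2 3 / S)
    \<le> f1 * (20 * \<mu> 1 / w + 11/10 * ((S1 1)^2 / S^2) - a / 2)
    + f2 * (20 * \<mu> 2 / w + 11/10 * ((S1 2)^2 / S^2) - a / 2)
    + f3 * (20 * \<mu> 3 / w + 11/10 * ((S1 3)^2 / S^2) - a / 2)"
    using fpos by (intro add_mono mult_left_mono log) auto
  also have "\<dots> = 20 / w * (f1 * \<mu> 1 + f2 * \<mu> 2 + f3 * \<mu> 3)
      + 11/10 * (f1 * (S1 1)^2 + f2 * (S1 2)^2 + f3 * (S1 3)^2) / S / S - a / 2 * (f1 + f2 + f3)"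
    by (simp add: power2_eq_square add_divide_distrib algebra_simps)
  also have "f1 * \<mu> 1 + f2 * \<mu> 2 + f3 * \<mu> 3 = 3" by fact
  \<comment> \<open>By the Jacobi inequality the gradient terms are at most the left-hand side of
    the chain, so both drop out.\<close>
  also have "11/10 * (f1 * (S1 1)^2 + f2 * (S1 2)^2 + f3 * (S1 3)^2) / S / S
      \<le> (f1 * S2 1 + f2 * S2 2 + f3 * S2 3) / S"
    using jacobi bpos by (intro divide_right_mono) auto
  finally have "a / 2 * (f1 + f2 + f3) \<le> 60 / w"
    by (simp add: add_divide_distrib)
  moreover have "2 * S^2 / 9 \<le> f1 + f2 + f3"
  proof -
    have "2 / b1 \<le> f1 + f2 + f3"
      using bpos b by (simp add: f1_def f2_def f3_def)
    then show ?thesis using gap(3) by linarith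
  qed
  then have "a / 2 * (2 * S^2 / 9) \<le> a / 2 * (f1 + f2 + f3)"
    using d by (intro mult_left_mono) (auto simp: a)
  ultimately have "a / 2 * (2 * S^2 / 9) \<le> 60 / w" by linarith
  \<comment> \<open>With \<open>a = 5 / d^2\<close> the left-hand side is
    \<open>5 * S^2 / (9 * d^2)\<close>, and \<open>60 * 9 / 5 = 108\<close>.\<close>
  then have "S^2 * w \<le> 108 * d^2"
    using d bpos by (simp add: a field_simps)
  then show ?thesis
    by (simp add: S_def w_def)
qed

section \<open>Maximum principle and the global estimate\<close>

text \<open>A positive maximum over the closure would lie in the interior, where every pure second
  derivative is at most 0, against the positive Laplacian.\<close>

lemma solution_nonpos:
  fixes u :: "real ^ 3 \<Rightarrow> real"
  assumes \<Omega>: "bounded_domain \<Omega>" and u: "smooth_on u \<Omega>" "continuous_on (closure \<Omega>) u"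
    and lap: "\<And>x. x \<in> \<Omega> \<Longrightarrow> 0 < laplacian u x"
    and bd: "\<And>x. x \<in> frontier \<Omega> \<Longrightarrow> u x = 0"
    and x: "x \<in> \<Omega>"
  shows "u x \<le> 0"
proof (rule ccontr)
  assume pos: "\<not> u x \<le> 0"
  have op: "open \<Omega>" "bounded \<Omega>"
    using \<Omega> by (auto simp: bounded_domain_def)
  have u2: "Ck_on (Suc (Suc 0)) u \<Omega>"
    using u(1) unfolding smooth_on_def by blast
  obtain y where y: "y \<in> closure \<Omega>" "\<And>z. z \<in> closure \<Omega> \<Longrightarrow> u z \<le> u y"
    using continuous_attains_sup[of "closure \<Omega>" u] op u(2) x closure_subset compact_closure by blast
  have "u y > 0"
    using y(2)[of x] x pos closure_subset by force
  then have "y \<in> \<Omega>"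
    using y(1) bd[of y] op(1) by (auto simp: frontier_def interior_open)
  then obtain r where r: "r > 0" "ball y r \<subseteq> \<Omega>"
    using op(1) openE by blast
  have "partial_deriv i (partial_deriv i u) y \<le> 0" for i
  proof -
    let ?e = "axis i 1 :: real ^ 3"
    have line: "y + t *\<^sub>R ?e \<in> \<Omega>" if "\<bar>t\<bar> < r" for t
      using that r(2) by (auto simp: dist_norm subset_iff)
    have "dderiv ?e (dderiv ?e u) (y + 0 *\<^sub>R ?e) \<le> 0"
    proof (rule second_derivative_test(2)[OF r(1)])
      show "((\<lambda>t. u (y + t *\<^sub>R ?e)) has_real_derivative dderiv ?e u (y + t *\<^sub>R ?e)) (at t)" if "\<bar>t\<bar> < r" for t
        using u2 line[OF that] by (intro has_real_derivative_line) auto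
      show "((\<lambda>t. dderiv ?e u (y + t *\<^sub>R ?e)) has_real_derivative dderiv ?e (dderiv ?e u) (y + 0 *\<^sub>R ?e)) (at 0)"
        using u2 line[of 0] r(1) by (intro has_real_derivative_line) auto
      show "u (y + t *\<^sub>R ?e) \<le> u (y + 0 *\<^sub>R ?e)" if "\<bar>t\<bar> < r" for t
        using y(2) line[OF that] closure_subset by auto
    qed
    then show ?thesis
      by (simp add: partial_deriv_def[abs_def])
  qed
  then have "laplacian u y \<le> 0"
    unfolding laplacian_def by (intro sum_nonpos)
  then show False
    using lap[OF \<open>y \<in> \<Omega>\<close>] by simp
qed

lemma laplacian_continuous:
  fixes u :: "real ^ 'n \<Rightarrow> real"
  assumes "smooth_on u \<Omega>"
  shows "continuous_on \<Omega> (laplacian u)"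
proof -
  have "Ck_on (Suc (Suc 0)) u \<Omega>"
    using assms unfolding smooth_on_def by blast
  then have "Ck_on 0 (dderiv v (dderiv v u)) \<Omega>" for v
    by (blast intro: Ck_on_dderiv)
  then show ?thesis
    unfolding laplacian_def[abs_def] partial_deriv_def[abs_def]
    by (intro continuous_on_sum) simp
qed

text \<open>The solution need not be smooth up to the boundary, so the weight \<open>-u\<close> is replaced by \<open>-u - \<epsilon>\<close>,
  which is positive only on a relatively compact subset of the domain.\<close>

lemma shifted_pogorelov_estimate:
  fixes u :: "real ^ 3 \<Rightarrow> real" and ev :: "real ^ 3 \<Rightarrow> real ^ 3"
  assumes \<Omega>: "bounded_domain \<Omega>" and u: "smooth_on u \<Omega>" "continuous_on (closure \<Omega>) u"
    and ev: "\<And>x. x \<in> \<Omega> \<Longrightarrow> is_eigenvalues (hessian u x) (ev x)" "\<And>x. x \<in> \<Omega> \<Longrightarrow> ev x \<in> P2_half"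
    and eq: "\<And>x. x \<in> \<Omega> \<Longrightarrow> (ev x $ 1 + ev x $ 2) * (ev x $ 1 + ev x $ 3) * (ev x $ 2 + ev x $ 3) = 1"
    and bd: "\<And>x. x \<in> frontier \<Omega> \<Longrightarrow> u x = 0"
    and M: "\<And>x. x \<in> \<Omega> \<Longrightarrow> \<bar>u x\<bar> \<le> M"
    and c: "c \<in> \<Omega>" "u c < - \<epsilon>" "0 < \<epsilon>"
  shows "(- u c - \<epsilon>)^20 * laplacian u c \<le> (11 * M^20 + 10 * M^19 * (diameter \<Omega>)^2) * exp (5/2)"
proof -
  have op: "open \<Omega>" "bounded \<Omega>"
    using \<Omega> by (auto simp: bounded_domain_def)
  define d where "d = diameter \<Omega>"
  have d: "0 < d"
  proof -
    obtain r where "r > 0" "cball c r \<subseteq> \<Omega>"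
      using op(1) c(1) open_contains_cball by blast
    then have "diameter (cball c r) \<le> d"
      unfolding d_def by (intro diameter_subset op)
    then show ?thesis
      using \<open>r > 0\<close> by simp
  qed
  have lap: "0 < laplacian u x" if "x \<in> \<Omega>" for x
    using laplacian_pos[OF ev(1)[OF that] ev(2)[OF that]] .
  define a where "a = 5 / d^2"
  define K where "K = {x \<in> closure \<Omega>. u x \<le> - \<epsilon>}"
  have K: "compact K"
  proof -
    have "closed K"
      unfolding K_def by (intro continuous_on_closed_Collect_le u(2) continuous_intros) auto
    moreover have "bounded K"
      using op(2) by (auto intro: bounded_subset[OF bounded_closure] simp: K_def)
    ultimately show ?thesis
      by (simp add: compact_eq_bounded_closed)
  qed
  have K\<Omega>: "K \<subseteq> \<Omega>"
    using bd c(3) op(1) by (force simp: K_def frontier_def interior_open)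
  have cK: "c \<in> K"
    using c closure_subset by (auto simp: K_def)
  \<comment> \<open>\<open>g\<close> is the exponential of the test function, written as a product
    so that it is continuous where the weight vanishes. Centring the quadratic term at
    \<open>c\<close> makes \<open>g c\<close> the very quantity to be bounded.\<close>
  define g where "g x = (- \<epsilon> - u x)^20 * laplacian u x * exp (a / 2 * (norm (x - c))^2)" for x
  have "continuous_on K g"
    unfolding g_def
    by (intro continuous_intros continuous_on_subset[OF laplacian_continuous[OF u(1)] K\<Omega>]
        continuous_on_subset[OF u(2)]) (auto simp: K_def)
  then obtain x0 where x0: "x0 \<in> K" "\<And>y. y \<in> K \<Longrightarrow> g y \<le> g x0"
    using continuous_attains_sup[OF K] cK by blast
  have x0\<Omega>: "x0 \<in> \<Omega>" using x0 K\<Omega> by blast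
  define w where "w = - \<epsilon> - u x0"
  \<comment> \<open>The weight vanishes where \<open>u = - \<epsilon>\<close>, so a positive maximum
    of \<open>g\<close> lies in the open set \<open>u < - \<epsilon>\<close>, where logarithms may
    be taken.\<close>
  have "0 < g c"
    using c lap[OF c(1)] by (simp add: g_def)
  then have "0 < g x0"
    using x0(2)[OF cK] by simp
  then have "u x0 \<noteq> - \<epsilon>"
    by (auto simp: g_def)
  then have w: "0 < w"
    using x0(1) by (simp add: w_def K_def)
  have "open {x \<in> \<Omega>. u x < - \<epsilon>}"
    using continuous_open_preimage[OF continuous_on_subset[OF u(2) closure_subset] op(1) open_lessThan, of "- \<epsilon>"]
    by (simp add: Int_def)
  then obtain r where r: "0 < r" "ball x0 r \<subseteq> {x \<in> \<Omega>. u x < - \<epsilon>}"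
    using x0\<Omega> w openE[of "{x \<in> \<Omega>. u x < - \<epsilon>}" x0] by (auto simp: w_def)
  have near: "norm (x0 - c) \<le> d"
    using diameter_bounded_bound[OF op(2) x0\<Omega> c(1)] by (simp add: dist_norm d_def)
  have lng: "ln (g y) = 20 * ln (- \<epsilon> - u y) + ln (laplacian u y) + a / 2 * (norm (y - c))^2"
    if "y \<in> \<Omega>" "u y < - \<epsilon>" for y
  proof -
    have "ln ((- \<epsilon> - u y)^20) = 20 * ln (- \<epsilon> - u y)"
      using that by (simp add: ln_realpow)
    then show ?thesis
      using that lap[OF that(1)] by (simp add: g_def ln_mult)
  qed
  have "20 * ln (- \<epsilon> - u x) + ln (laplacian u x) + a / 2 * (norm (x - c))^2
      \<le> 20 * ln (- \<epsilon> - u x0) + ln (laplacian u x0) + a / 2 * (norm (x0 - c))^2"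
    if "x \<in> ball x0 r" for x
  proof -
    have x: "x \<in> \<Omega>" "u x < - \<epsilon>"
      using that r(2) by auto
    then have "g x \<le> g x0"
      using closure_subset by (intro x0(2)) (auto simp: K_def)
    moreover have "0 < g x"
      using x lap[OF x(1)] by (simp add: g_def)
    ultimately have "ln (g x) \<le> ln (g x0)"
      using ln_mono by blast
    then show ?thesis
      using lng[OF x] lng[OF x0\<Omega>] w by (simp add: w_def)
  qed
  moreover have "Ck_on 4 u \<Omega>"
    using u(1) by (auto simp: smooth_on_def)
  ultimately have max: "11 \<le> laplacian u x0 \<Longrightarrow> (laplacian u x0)^2 * w \<le> 108 * d^2"
    using interior_maximum_bound[OF op(1) _ ev eq r(1) _ _ d near a_def, of "- \<epsilon>"] r(2)
    by (auto simp: w_def subset_iff)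
  have wM: "w \<le> M"
    using M[OF x0\<Omega>] c(3) by (simp add: w_def)
  have bound: "w^20 * laplacian u x0 \<le> 11 * M^20 + 10 * M^19 * d^2"
  proof (cases "laplacian u x0 \<le> 11")
    case True
    have "w^20 * laplacian u x0 \<le> M^20 * 11"
      using w wM True lap[OF x0\<Omega>] by (intro mult_mono power_mono) auto
    moreover have "0 \<le> 10 * M^19 * d^2"
      using w wM by simp
    ultimately show ?thesis by linarith
  next
    case False
    \<comment> \<open>One of the two factors \<open>laplacian u x0\<close> in the interior bound is
      replaced by its lower bound 11, and \<open>108 / 11 < 10\<close>. The spare power
      \<open>w^19\<close> is bounded by \<open>M^19\<close>.\<close>
    have "11 * (w * laplacian u x0) \<le> laplacian u x0 * (w * laplacian u x0)"
      using w False by (intro mult_right_mono) auto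
    also have "\<dots> \<le> 108 * d^2"
      using max False by (simp add: power2_eq_square mult_ac)
    finally have "w * laplacian u x0 \<le> 10 * d^2"
      using zero_le_power2[of d] by argo
    moreover have "w^19 \<le> M^19"
      using w wM by (intro power_mono) auto
    ultimately have "w^19 * (w * laplacian u x0) \<le> M^19 * (10 * d^2)"
      using w wM lap[OF x0\<Omega>] mult_mono[of "w^19" "M^19" "w * laplacian u x0" "10 * d^2"] by simp
    moreover have "w^19 * (w * laplacian u x0) = w^20 * laplacian u x0"
      by (simp add: power_numeral_reduce)
    ultimately have "w^20 * laplacian u x0 \<le> M^19 * (10 * d^2)"
      by simp
    also have "\<dots> \<le> 11 * M^20 + 10 * M^19 * d^2"
      by (simp add: mult_ac)
    finally show ?thesis .
  qed
  have "(- u c - \<epsilon>)^20 * laplacian u c = g c"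
    by (simp add: g_def minus_diff_commute[of "u c"])
  also have "\<dots> \<le> g x0"
    by (rule x0(2)[OF cK])
  also have "\<dots> = (w^20 * laplacian u x0) * exp (a / 2 * (norm (x0 - c))^2)"
    by (simp add: g_def w_def)
  also have "\<dots> \<le> (11 * M^20 + 10 * M^19 * d^2) * exp (5/2)"
  proof (intro mult_mono bound)
    have "a / 2 * (norm (x0 - c))^2 \<le> a / 2 * d^2"
      using near by (intro mult_left_mono power_mono) (auto simp: a_def)
    also have "\<dots> = 5/2"
      using d by (simp add: a_def)
    finally show "exp (a / 2 * (norm (x0 - c))^2) \<le> exp (5/2)"
      by simp
    show "0 \<le> 11 * M^20 + 10 * M^19 * d^2"
      using w wM by (intro add_nonneg_nonneg) auto
  qed auto
  finally show ?thesis
    by (simp add: d_def)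
qed

theorem lemma3p1:
  shows "\<exists>(C :: real \<Rightarrow> real \<Rightarrow> real) (\<beta> :: real \<Rightarrow> real \<Rightarrow> real).
    (\<forall>M d. C M d > 0 \<and> \<beta> M d > 0) \<and>
    (\<forall>(\<Omega> :: (real ^ 3) set) (u :: real ^ 3 \<Rightarrow> real) (ev :: real ^ 3 \<Rightarrow> real ^ 3).
       bounded_domain \<Omega> \<longrightarrow>
       smooth_on u \<Omega> \<longrightarrow>
       continuous_on (closure \<Omega>) u \<longrightarrow>
       (\<forall>x\<in>\<Omega>. is_eigenvalues (hessian u x) (ev x) \<and> ev x \<in> P2_half) \<longrightarrow>
       (\<forall>x\<in>\<Omega>. (ev x $ 1 + ev x $ 2) * (ev x $ 1 + ev x $ 3) * (ev x $ 2 + ev x $ 3) = 1) \<longrightarrow>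
       (\<forall>x\<in>frontier \<Omega>. u x = 0) \<longrightarrow>
       (\<forall>x\<in>\<Omega>. (- u x) powr (\<beta> (sup_norm_on \<Omega> u) (diameter \<Omega>)) * laplacian u x
                \<le> C (sup_norm_on \<Omega> u) (diameter \<Omega>)))"
proof (intro exI conjI allI impI ballI)
  let ?A = "\<lambda>M d :: real. (11 * M^20 + 10 * M^19 * d^2) * exp (5/2)"
  \<comment> \<open>The factor \<open>2^20\<close> comes from taking \<epsilon> to be half of
    \<open>- u x\<close>. The absolute value and the summand 1 make the constant positive for all
    real arguments, not only for norms.\<close>
  let ?C = "\<lambda>M d :: real. 2^20 * ?A \<bar>M\<bar> d + 1"
  let ?\<beta> = "\<lambda>M d :: real. 20 :: real"
  fix M d :: real
  show "0 < ?C M d"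
    by (intro add_nonneg_pos mult_nonneg_nonneg add_nonneg_nonneg) auto
  show "0 < ?\<beta> M d"
    by simp
  fix \<Omega> :: "(real ^ 3) set" and u :: "real ^ 3 \<Rightarrow> real" and ev :: "real ^ 3 \<Rightarrow> real ^ 3" and x
  assume \<Omega>: "bounded_domain \<Omega>" and u: "smooth_on u \<Omega>" "continuous_on (closure \<Omega>) u"
    and ev: "\<forall>x\<in>\<Omega>. is_eigenvalues (hessian u x) (ev x) \<and> ev x \<in> P2_half"
    and eq: "\<forall>x\<in>\<Omega>. (ev x $ 1 + ev x $ 2) * (ev x $ 1 + ev x $ 3) * (ev x $ 2 + ev x $ 3) = 1"
    and bd: "\<forall>x\<in>frontier \<Omega>. u x = 0" and x: "x \<in> \<Omega>"
  let ?M = "sup_norm_on \<Omega> u" and ?d = "diameter \<Omega>"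
  have lap: "0 < laplacian u y" if "y \<in> \<Omega>" for y
    using ev that laplacian_pos by blast
  have "bdd_above ((\<lambda>x. \<bar>u x\<bar>) ` closure \<Omega>)"
    using \<Omega> u(2) by (intro bounded_imp_bdd_above compact_imp_bounded compact_continuous_image continuous_intros)
      (auto simp: bounded_domain_def compact_closure)
  then have "bdd_above ((\<lambda>x. \<bar>u x\<bar>) ` \<Omega>)"
    by (rule bdd_above_mono) (use closure_subset in auto)
  then have M: "\<bar>u y\<bar> \<le> ?M" if "y \<in> \<Omega>" for y
    unfolding sup_norm_on_def using that by (intro cSUP_upper)
  then have M0: "\<bar>?M\<bar> = ?M"
    using x by force
  have "0 \<le> ?A \<bar>?M\<bar> ?d"
    by (intro mult_nonneg_nonneg add_nonneg_nonneg) auto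
  show "(- u x) powr ?\<beta> ?M ?d * laplacian u x \<le> ?C ?M ?d"
  proof (cases "u x = 0")
    case True
    then show ?thesis
      using \<open>0 \<le> ?A \<bar>?M\<bar> ?d\<close> by simp
  next
    case False
    then have neg: "u x < 0"
      using solution_nonpos[OF \<Omega> u lap _ x] bd by force
    have "(- u x - (- u x / 2))^20 * laplacian u x \<le> ?A ?M ?d"
      by (rule shifted_pogorelov_estimate[OF \<Omega> u, where ev = ev]) (use ev eq bd M x neg in auto)
    also have "- u x - (- u x / 2) = - u x / 2"
      by simp
    finally have "(- u x)^20 * laplacian u x \<le> 2^20 * ?A ?M ?d"
      by (simp add: power_divide)
    moreover have "(- u x) powr 20 = (- u x)^20"
      using neg powr_realpow[of "- u x" 20] by simp
    ultimately show ?thesis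
      using M0 by simp
  qed
qed

end
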